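(* Let $F$ be a full vertex algebra. Then $\ker\bar D$ is a vertex algebra (with vacuum $\mathbf 1$ and vertex operators $Y(a,z)=\sum_{n\in\mathbb Z}a(n,-1)z^{-n-1}$ for $a\in\ker\bar D$, obtained by restricting $Y$), and $F$ is a $\ker\bar D$-module.
   Context: **Conventions.** $z,\bar z$ are independent formal variables, $\underline z=(z,\bar z)$, and $|z|$ stands for $z\bar z$ in exponents, so $|z|^r=z^r\bar z^r$. For a vector space $V$, $V[[z,\bar z,|z|^{\mathbb R}]]$ is the set of formal sums $\sum_{r,s\in\mathbb R}a_{r,s}z^r\bar z^s$ with countable support and $a_{r,s}=0$ unless $r-s\in\mathbb Z$; $V((z,\bar z,|z|^{\mathbb R}))$ is the subspace of those for which there is $N$ with $a_{r,s}=0$ unless $r,s\ge N$. **Function spaces.** $F_{0,1,\infty}$ is the space of real analytic functions $f:\mathbb CP^1\setminus\{0,1,\infty\}\to\mathbb C$ with conformal singularities at $0,1,\infty$: for each $\alpha\in\{0,1,\infty\}$ and each holomorphic chart $\chi$ at $\alpha$ with $\chi(\alpha)=0$ there is a series in $\mathbb C((p,\bar p,|p|^{\mathbb R}))$ converging absolutely and compactly to $f\circ\chi^{-1}(p)$ in some punctured disc around $p=0$. For $\chi\in\{p,1/p,1-1/p\}$ ($p$ the standard coordinate) this uniquely determined series is denoted $j(\chi,f)$. $\mathrm{GCor}_2$ is the complex span of the functions on $Y_2=\{(z_1,z_2)\in\mathbb C^2: z_1\ne z_2, z_1\ne0,z_2\neq 0\}$ $$\mu=z_1^{\alpha_1}z_2^{\alpha_2}(z_1-z_2)^{\alpha_{12}}\bar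 z_1^{\beta_1}\bar z_2^{\beta_2}(\bar z_1-\bar z_2)^{\beta_{12}}f(z_2/z_1),$$ $f\in F_{0,1,\infty}$, $\alpha$'s, $\beta$'s real with $\alpha_1-\beta_1,\alpha_2-\beta_2,\alpha_{12}-\beta_{12}\in\mathbb Z$. Its expansions, extended linearly, are: $\mu|_{|z_1|>|z_2|}$: expand $(z_1-z_2)^{\alpha_{12}}(\bar z_1-\bar z_2)^{\beta_{12}}$ binomially in non-negative powers of $z_2/z_1,\bar z_2/\bar z_1$ and replace $f(z_2/z_1)$ by $j(p,f)$ at $p=z_2/z_1$; $\mu|_{|z_2|>|z_1|}$: expand in non-negative powers of $z_1/z_2,\bar z_1/\bar z_2$ (with sign $(-1)^{\alpha_{12}-\beta_{12}}$) and replace $f(z_2/z_1)$ by $j(p^{-1},f)$ at $p=z_1/z_2$; $\mu|_{|z_2|>|z_1-z_2|}$: put $z_1=z_2+z_0$, expand $(z_2+z_0)^{\alpha_1}(\bar z_2+\bar z_0)^{\beta_1}$ in non-negative powers of $z_0/z_2,\bar z_0/\bar z_2$ and replace $f(z_2/z_1)$ by $j(1-p^{-1},f)$ at $p=-z_0/z_2$. **Full vertex algebra.** For $F=\bigoplus_{h,\bar h\in\mathbb R}F_{h,\bar h}$ put $F^\vee=\bigoplus F_{h,\bar h}^*$. A full vertex algebra is such an $F$ over $\mathbb C$ with $Y(-,\underline z):F\to\mathrm{End}(F)[[z,\bar z,|z|^{\mathbb R}]]$, $Y(a,\underline z)=\sum_{r,s\in\mathbb R}a(r,s)z^{-r-1}\bar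 z^{-s-1}$, and $\mathbf 1\in F_{0,0}$ such that: (FV1) for all $a,b$ there is $N$ with $a(r,s)b=0$ if $r\ge N$ or $s\ge N$; (FV2) $F_{h,\bar h}=0$ unless $h-\bar h\in\mathbb Z$; (FV3) $Y(a,\underline z)\mathbf 1\in F[[z,\bar z]]$ with constant term $a$; (FV4) $Y(\mathbf 1,\underline z)=\mathrm{id}$; (FV5) for all $a,b,c\in F$, $u\in F^\vee$ there is $\mu\in\mathrm{GCor}_2$ with $u(Y(a,\underline z_1)Y(b,\underline z_2)c)=\mu|_{|z_1|>|z_2|}$, $u(Y(Y(a,\underline z_0)b,\underline z_2)c)=\mu|_{|z_2|>|z_1-z_2|}$ ($z_0=z_1-z_2$), $u(Y(b,\underline z_2)Y(a,\underline z_1)c)=\mu|_{|z_2|>|z_1|}$; (FV6) $F_{h,\bar h}(r,s)F_{h',\bar h'}\subset F_{h+h'-r-1,\bar h+\bar h'-s-1}$. $D,\bar D\in\mathrm{End}F$ are defined by $Y(a,\underline z)\mathbf 1=a+Da\,z+\bar Da\,\bar z+\cdots$. For $a\in\ker\bar D$ one has $a(r,s)=0$ unless $s=-1$ and $r\in\mathbb Z$, and $Y(a,\underline z)$ preserves $\ker\bar D$. *)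

theory Defs
  imports "HOL-Analysis.Analysis" "HOL-Library.Groups_Big_Fun"
begin

section \<open>Formal series with real exponents\<close>

text \<open>
  A series \<open>a :: real \<Rightarrow> real \<Rightarrow> complex\<close> stands for the formal sum of \<open>a r s z^r zbar^s\<close> over
  all real \<open>r, s\<close>.
\<close>

definition R_support :: "(real \<times> real) set \<Rightarrow> bool" where
  "R_support S \<longleftrightarrow> countable S \<and> (\<forall>(r, s) \<in> S. r - s \<in> \<int>)"

text \<open>The space \<open>C((z, zbar, |z|^R))\<close>.\<close>

definition R_laurent :: "(real \<Rightarrow> real \<Rightarrow> complex) set" where
  "R_laurent = {a. R_support {(r, s). a r s \<noteq> 0} \<and>
     (\<exists>N. \<forall>r s. a r s \<noteq> 0 \<longrightarrow> N \<le> r \<and> N \<le> s)}"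

text \<open>
  The single-valued function \<open>z^r zbar^s = z^(r-s) (z zbar)^s\<close> on the punctured plane, to be used
  for \<open>r - s \<in> \<int>\<close> only.
\<close>

definition cpow :: "real \<Rightarrow> real \<Rightarrow> complex \<Rightarrow> complex" where
  "cpow r s z = z powi \<lfloor>r - s\<rfloor> * complex_of_real ((cmod z)\<^sup>2 powr s)"

definition conf_converges :: "(real \<Rightarrow> real \<Rightarrow> complex) \<Rightarrow> (complex \<Rightarrow> complex) \<Rightarrow> bool" where
  "conf_converges a g \<longleftrightarrow> a \<in> R_laurent \<and>
     (\<exists>R>0.
        (\<forall>q. 0 < cmod q \<and> cmod q < R \<longrightarrow>
           (\<lambda>(r, s). cmod (a r s * cpow r s q)) summable_on UNIV) \<and>
        (\<forall>K. compact K \<and> K \<subseteq> ball 0 R - {0} \<longrightarrow>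
           uniform_limit K (\<lambda>X q. \<Sum>(r, s)\<in>X. a r s * cpow r s q) g
             (finite_subsets_at_top UNIV)))"


section \<open>Functions with conformal singularities at 0, 1 and infinity\<close>

definition real_analytic_on :: "(complex \<Rightarrow> complex) \<Rightarrow> complex set \<Rightarrow> bool" where
  "real_analytic_on f S \<longleftrightarrow>
     (\<forall>w\<in>S. \<exists>e>0. \<exists>c :: nat \<Rightarrow> nat \<Rightarrow> complex. \<forall>z\<in>ball w e.
        ((\<lambda>(m, n). c m n * complex_of_real (Re (z - w) ^ m * Im (z - w) ^ n)) has_sum f z) UNIV)"

text \<open>
  Up to shrinking its domain, a holomorphic chart \<open>\<chi>\<close> at 0, 1 or infinity with value 0 there is
  given by its inverse, which has the form \<open>\<phi>\<close>, \<open>1 + \<phi>\<close> or \<open>1 / \<phi>\<close> for exactly one germ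
  \<open>\<phi>\<close> of an injective holomorphic map fixing 0.
\<close>

definition local_chart :: "(complex \<Rightarrow> complex) \<Rightarrow> bool" where
  "local_chart \<phi> \<longleftrightarrow> (\<exists>e>0. \<phi> holomorphic_on ball 0 e \<and> inj_on \<phi> (ball 0 e)) \<and> \<phi> 0 = 0"

definition F01inf :: "(complex \<Rightarrow> complex) set" where
  "F01inf = {f. real_analytic_on f (- {0, 1}) \<and>
     (\<forall>\<phi>. local_chart \<phi> \<longrightarrow>
        (\<exists>a. conf_converges a (\<lambda>q. f (\<phi> q))) \<and>
        (\<exists>a. conf_converges a (\<lambda>q. f (1 + \<phi> q))) \<and>
        (\<exists>a. conf_converges a (\<lambda>q. f (1 / \<phi> q))))}"


section \<open>Generalized two-point correlation functions and their expansions\<close>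

text \<open>
  A series in two pairs of variables is a function \<open>S x y x' y'\<close>, the coefficient of
  \<open>z^x zbar^y w^x' wbar^y'\<close>.  The next operator maps \<open>g(p)\<close> to
  \<open>z^A zbar^B g(w/z)\<close>.
\<close>

type_synonym series2 = "real \<Rightarrow> real \<Rightarrow> real \<Rightarrow> real \<Rightarrow> complex"

definition ratio_series :: "real \<Rightarrow> real \<Rightarrow> (real \<Rightarrow> real \<Rightarrow> complex) \<Rightarrow> series2" where
  "ratio_series A B g = (\<lambda>x y x' y'. if x + x' = A \<and> y + y' = B then g x' y' else 0)"

text \<open>
  The product of \<open>a(p)\<close> with the binomial expansion of \<open>(1 + \<epsilon> p)^\<alpha> (1 + \<epsilon> pbar)^\<beta>\<close>
  in non-negative powers, for \<open>\<epsilon> = 1\<close> or \<open>\<epsilon> = -1\<close>; the sum is finite for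
  \<open>a \<in> R_laurent\<close>.
\<close>

definition binom_mult ::
  "real \<Rightarrow> real \<Rightarrow> complex \<Rightarrow> (real \<Rightarrow> real \<Rightarrow> complex) \<Rightarrow> real \<Rightarrow> real \<Rightarrow> complex" where
  "binom_mult \<alpha> \<beta> \<epsilon> a r s = Sum_any (\<lambda>(m :: nat, n :: nat).
     complex_of_real (\<alpha> gchoose m) * complex_of_real (\<beta> gchoose n) * \<epsilon> ^ (m + n)
       * a (r - real m) (s - real n))"

text \<open>
  \<open>GCor2 \<mu> S12 S20 S21\<close> says that \<open>\<mu>\<close> lies in the span \<open>GCor_2\<close> and that its expansions,
  extended linearly from the generators, are: \<open>S12\<close> in \<open>|z1| > |z2|\<close>, with variables
  \<open>(z1, z2)\<close>; \<open>S20\<close> in \<open>|z2| > |z1 - z2|\<close>, with variables \<open>(z2, z0)\<close>; and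
  \<open>S21\<close> in \<open>|z2| > |z1|\<close>, with variables \<open>(z2, z1)\<close>.  Only the values of \<open>\<mu>\<close> on
  \<open>z1 \<noteq> z2\<close>, \<open>z1 \<noteq> 0\<close>, \<open>z2 \<noteq> 0\<close> are meaningful.

  The series \<open>a0\<close>, \<open>ainf\<close>, \<open>a1\<close> are \<open>j(p, f)\<close>, \<open>j(1/p, f)\<close>, \<open>j(1 - 1/p, f)\<close>;
  they are uniquely determined by convergence, so stating convergence identifies them.
  The inverses of these charts are \<open>q\<close>, \<open>1/q\<close>, \<open>1/(1 - q)\<close>.  The last series is
  evaluated at \<open>q = - z0/z2\<close>, which gives the sign \<open>(-1)^(r-s)\<close>.
\<close>

inductive GCor2 :: "(complex \<Rightarrow> complex \<Rightarrow> complex) \<Rightarrow> series2 \<Rightarrow> series2 \<Rightarrow> series2 \<Rightarrow> bool" where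
  generator:
    "GCor2
       (\<lambda>z1 z2. cpow \<alpha>1 \<beta>1 z1 * cpow \<alpha>2 \<beta>2 z2 * cpow \<alpha>12 \<beta>12 (z1 - z2) * f (z2 / z1))
       (ratio_series (\<alpha>1 + \<alpha>2 + \<alpha>12) (\<beta>1 + \<beta>2 + \<beta>12)
          (\<lambda>r s. binom_mult \<alpha>12 \<beta>12 (- 1) a0 (r - \<alpha>2) (s - \<beta>2)))
       (ratio_series (\<alpha>1 + \<alpha>2 + \<alpha>12) (\<beta>1 + \<beta>2 + \<beta>12)
          (\<lambda>r s. binom_mult \<alpha>1 \<beta>1 1 (\<lambda>r' s'. (- 1) powi \<lfloor>r' - s'\<rfloor> * a1 r' s')
                   (r - \<alpha>12) (s - \<beta>12)))
       (ratio_series (\<alpha>1 + \<alpha>2 + \<alpha>12) (\<beta>1 + \<beta>2 + \<beta>12)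
          (\<lambda>r s. (- 1) powi \<lfloor>\<alpha>12 - \<beta>12\<rfloor>
                   * binom_mult \<alpha>12 \<beta>12 (- 1) ainf (r - \<alpha>1) (s - \<beta>1)))"
    if "f \<in> F01inf" "\<alpha>1 - \<beta>1 \<in> \<int>" "\<alpha>2 - \<beta>2 \<in> \<int>" "\<alpha>12 - \<beta>12 \<in> \<int>"
       "conf_converges a0 f"
       "conf_converges ainf (\<lambda>q. f (1 / q))"
       "conf_converges a1 (\<lambda>q. f (1 / (1 - q)))"
| add:
    "GCor2 (\<lambda>z1 z2. \<mu> z1 z2 + \<mu>' z1 z2)
       (\<lambda>x y x' y'. S12 x y x' y' + T12 x y x' y')
       (\<lambda>x y x' y'. S20 x y x' y' + T20 x y x' y')
       (\<lambda>x y x' y'. S21 x y x' y' + T21 x y x' y')"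
    if "GCor2 \<mu> S12 S20 S21" "GCor2 \<mu>' T12 T20 T21"
| smult:
    "GCor2 (\<lambda>z1 z2. k * \<mu> z1 z2)
       (\<lambda>x y x' y'. k * S12 x y x' y')
       (\<lambda>x y x' y'. k * S20 x y x' y')
       (\<lambda>x y x' y'. k * S21 x y x' y')"
    if "GCor2 \<mu> S12 S20 S21"


section \<open>Full vertex algebras\<close>

text \<open>
  The space \<open>F\<close> is the whole type, with grading \<open>gr h hbar\<close>, and \<open>Y a r s\<close> is the mode
  \<open>a(r, s)\<close>, the coefficient of \<open>z^(-r-1) zbar^(-s-1)\<close> in \<open>Y(a, z)\<close>.
\<close>

text \<open>
  The restricted dual: the sum of the duals of the graded pieces, each extended by 0 to the
  other pieces.
\<close>

definition restricted_dual ::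
  "(complex \<Rightarrow> 'a \<Rightarrow> 'a) \<Rightarrow> (real \<Rightarrow> real \<Rightarrow> 'a set) \<Rightarrow> ('a :: ab_group_add \<Rightarrow> complex) set" where
  "restricted_dual sc gr =
     {u. Vector_Spaces.linear sc (*) u \<and> finite {(h, hb). \<exists>x\<in>gr h hb. u x \<noteq> 0}}"

locale full_vertex_algebra = vector_space scale
  for scale :: "complex \<Rightarrow> 'a :: ab_group_add \<Rightarrow> 'a" +
  fixes gr :: "real \<Rightarrow> real \<Rightarrow> 'a set"
    and vac :: 'a
    and Y :: "'a \<Rightarrow> real \<Rightarrow> real \<Rightarrow> 'a \<Rightarrow> 'a"
  assumes gr_subspace: "subspace (gr h hb)"
    and gr_direct_sum:
      "\<exists>!c. finite {i. c i \<noteq> 0} \<and> (\<forall>h hb. c (h, hb) \<in> gr h hb) \<and> x = (\<Sum>i | c i \<noteq> 0. c i)"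
    and Y_linear_left: "Vector_Spaces.linear scale scale (\<lambda>a. Y a r s b)"
    and Y_linear_right: "Vector_Spaces.linear scale scale (Y a r s)"
    and Y_support: "R_support {(r, s). \<exists>b. Y a r s b \<noteq> 0}"
    and vac_grade: "vac \<in> gr 0 0"
    and FV1: "\<exists>N. \<forall>r s. r \<ge> N \<or> s \<ge> N \<longrightarrow> Y a r s b = 0"
    and FV2: "h - hb \<notin> \<int> \<Longrightarrow> gr h hb = {0}"
    and FV3_support: "Y a r s vac \<noteq> 0 \<Longrightarrow> - r - 1 \<in> \<nat> \<and> - s - 1 \<in> \<nat>"
    and FV3_const: "Y a (- 1) (- 1) vac = a"
    and FV4: "Y vac r s a = (if r = - 1 \<and> s = - 1 then a else 0)"
    and FV5: "u \<in> restricted_dual scale gr \<Longrightarrow>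
      \<exists>\<mu>. GCor2 \<mu>
        (\<lambda>x y x' y'. u (Y a (- x - 1) (- y - 1) (Y b (- x' - 1) (- y' - 1) c)))
        (\<lambda>x y x' y'. u (Y (Y a (- x' - 1) (- y' - 1) b) (- x - 1) (- y - 1) c))
        (\<lambda>x y x' y'. u (Y b (- x - 1) (- y - 1) (Y a (- x' - 1) (- y' - 1) c)))"
    and FV6: "a \<in> gr h hb \<Longrightarrow> b \<in> gr h' hb' \<Longrightarrow>
      Y a r s b \<in> gr (h + h' - r - 1) (hb + hb' - s - 1)"

text \<open>
  \<open>D a\<close> and \<open>Dbar a\<close> are the coefficients of \<open>z\<close> and of \<open>zbar\<close> in \<open>Y(a, z) 1\<close>.
\<close>

definition Dbar :: "('a \<Rightarrow> real \<Rightarrow> real \<Rightarrow> 'a \<Rightarrow> 'a) \<Rightarrow> 'a \<Rightarrow> 'a \<Rightarrow> 'a" where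
  "Dbar Y vac a = Y a (- 1) (- 2) vac"

definition ker_Dbar :: "('a :: zero \<Rightarrow> real \<Rightarrow> real \<Rightarrow> 'a \<Rightarrow> 'a) \<Rightarrow> 'a \<Rightarrow> 'a set" where
  "ker_Dbar Y vac = {a. Dbar Y vac a = 0}"


section \<open>Vertex algebras and modules\<close>

text \<open>
  Here \<open>Y a n\<close> is the mode \<open>a(n)\<close>, the coefficient of \<open>z^(-n-1)\<close> in \<open>Y(a, z)\<close>.  The
  vertex algebra and the module are subspaces \<open>V\<close>, \<open>M\<close> of the ambient types, and nothing is
  required of \<open>Y\<close> outside of them.
\<close>

definition lin_on ::
  "(complex \<Rightarrow> 'a \<Rightarrow> 'a) \<Rightarrow> 'a set \<Rightarrow> (complex \<Rightarrow> 'b \<Rightarrow> 'b) \<Rightarrow> 'b set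
     \<Rightarrow> ('a :: ab_group_add \<Rightarrow> 'b :: ab_group_add) \<Rightarrow> bool" where
  "lin_on s1 V s2 W f \<longleftrightarrow> f ` V \<subseteq> W \<and>
     (\<forall>x\<in>V. \<forall>y\<in>V. f (x + y) = f x + f y) \<and> (\<forall>k. \<forall>x\<in>V. f (s1 k x) = s2 k (f x))"

text \<open>
  The Borcherds identity.  All sums are finite when \<open>Y\<close> and \<open>YM\<close> satisfy the truncation
  condition.
\<close>

definition borcherds_identity ::
  "'a set \<Rightarrow> ('a \<Rightarrow> int \<Rightarrow> 'a \<Rightarrow> 'a) \<Rightarrow> (complex \<Rightarrow> 'm \<Rightarrow> 'm) \<Rightarrow> 'm set
     \<Rightarrow> ('a \<Rightarrow> int \<Rightarrow> 'm \<Rightarrow> 'm :: ab_group_add) \<Rightarrow> bool" where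
  "borcherds_identity V Y scaleM M YM \<longleftrightarrow>
     (\<forall>a\<in>V. \<forall>b\<in>V. \<forall>c\<in>M. \<forall>p q r :: int.
        Sum_any (\<lambda>i. scaleM (of_int p gchoose i) (YM (Y a (r + int i) b) (p + q - int i) c)) =
        Sum_any (\<lambda>i. scaleM ((- 1) ^ i * (of_int r gchoose i))
          (YM a (p + r - int i) (YM b (q + int i) c)
            - scaleM ((- 1) powi r) (YM b (q + r - int i) (YM a (p + int i) c)))))"

locale vertex_algebra = vector_space scale
  for scale :: "complex \<Rightarrow> 'a :: ab_group_add \<Rightarrow> 'a" +
  fixes V :: "'a set"
    and vac :: 'a
    and Y :: "'a \<Rightarrow> int \<Rightarrow> 'a \<Rightarrow> 'a"
  assumes V_subspace: "subspace V"
    and vac_in: "vac \<in> V"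
    and Y_linear_left: "b \<in> V \<Longrightarrow> lin_on scale V scale V (\<lambda>a. Y a n b)"
    and Y_linear_right: "a \<in> V \<Longrightarrow> lin_on scale V scale V (Y a n)"
    and truncation: "a \<in> V \<Longrightarrow> b \<in> V \<Longrightarrow> \<exists>N. \<forall>n\<ge>N. Y a n b = 0"
    and vacuum: "a \<in> V \<Longrightarrow> Y vac n a = (if n = - 1 then a else 0)"
    and creation: "a \<in> V \<Longrightarrow> n \<ge> 0 \<Longrightarrow> Y a n vac = 0"
    and creation_const: "a \<in> V \<Longrightarrow> Y a (- 1) vac = a"
    and borcherds: "borcherds_identity V Y scale V Y"

locale vertex_algebra_module =
  V: vertex_algebra scale V vac Y + M: vector_space scaleM
  for scale :: "complex \<Rightarrow> 'a :: ab_group_add \<Rightarrow> 'a"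
    and V :: "'a set"
    and vac :: 'a
    and Y :: "'a \<Rightarrow> int \<Rightarrow> 'a \<Rightarrow> 'a"
    and scaleM :: "complex \<Rightarrow> 'm :: ab_group_add \<Rightarrow> 'm" +
  fixes M :: "'m set"
    and YM :: "'a \<Rightarrow> int \<Rightarrow> 'm \<Rightarrow> 'm"
  assumes M_subspace: "M.subspace M"
    and YM_linear_left: "w \<in> M \<Longrightarrow> lin_on scale V scaleM M (\<lambda>a. YM a n w)"
    and YM_linear_right: "a \<in> V \<Longrightarrow> lin_on scaleM M scaleM M (YM a n)"
    and YM_truncation: "a \<in> V \<Longrightarrow> w \<in> M \<Longrightarrow> \<exists>N. \<forall>n\<ge>N. YM a n w = 0"
    and YM_vacuum: "w \<in> M \<Longrightarrow> YM vac n w = (if n = - 1 then w else 0)"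
    and YM_borcherds: "borcherds_identity V Y scaleM M YM"

end

theory Submission
  imports Defs "HOL-Complex_Analysis.Complex_Analysis"
begin

text \<open>
  The component of bidegree \<open>(A, B)\<close> of a correlation function is \<open>z1^A zbar1^B g(z2/z1)\<close> with a
  single real analytic function \<open>g\<close> on the plane without \<open>0\<close> and \<open>1\<close>.  Its expansions at \<open>0\<close>, at
  infinity and at \<open>1\<close> converge to the three formal series of the axiom (FV5): the products in both
  orders and the iterate (lemma \<open>GCor2_expansions\<close>).  Thus one expansion determines \<open>g\<close>, and \<open>g\<close>
  determines the others.

  If \<open>a\<close> is in the kernel of \<open>Dbar\<close>, applying this to \<open>a\<close> and the vacuum shows that \<open>Y(a, z)\<close> contains
  no \<open>zbar\<close> (lemma \<open>ker_Dbar_mode_support\<close>).  For \<open>a\<close> and \<open>b\<close> both in the kernel, acting on the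
  vacuum, it shows that the modes of \<open>a\<close> map \<open>b\<close> into the kernel (lemma \<open>ker_Dbar_closed\<close>).

  For the Borcherds identity, all three expansions are Laurent series in one variable as soon as
  \<open>a\<close> is in the kernel and \<open>B = 0\<close>.  So \<open>g\<close> is holomorphic near \<open>0\<close>, and a real analytic function
  on a connected set that is holomorphic somewhere is holomorphic everywhere (lemma
  \<open>complexifiable_on_holomorphic\<close>).  The identity is then the residue theorem for
  \<open>t^p (t - 1)^r H(t)\<close> with \<open>t = z1/z2\<close> and \<open>H(t) = t^A g(1/t)\<close> (lemma \<open>residue_identity\<close>).  It holds
  for all \<open>b\<close> and \<open>c\<close> in \<open>F\<close>, which gives the vertex algebra and the module at once.
\<close>

section \<open>Real analytic functions and propagation of holomorphy\<close>

text \<open>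
  A function of two complex variables on the bidisc of radius \<open>e\<close> counts as holomorphic when its
  pullback along every pair of holomorphic functions with values in the disc of radius \<open>e\<close> is.  This
  contains separate holomorphy, it survives the linear changes of variables used below, and it is
  closed under sums and products, so Hartogs' theorem is not needed.
\<close>

definition hol_on_curves :: "(complex \<Rightarrow> complex \<Rightarrow> complex) \<Rightarrow> real \<Rightarrow> bool" where
  "hol_on_curves \<Phi> e \<longleftrightarrow> (\<forall>U \<alpha> \<beta>. open U \<and> \<alpha> holomorphic_on U \<and> \<beta> holomorphic_on U \<and>
     \<alpha> ` U \<subseteq> ball 0 e \<and> \<beta> ` U \<subseteq> ball 0 e \<longrightarrow> (\<lambda>\<zeta>. \<Phi> (\<alpha> \<zeta>) (\<beta> \<zeta>)) holomorphic_on U)"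

text \<open>
  Near every point of \<open>S\<close>, in terms of the real coordinates \<open>x\<close>, \<open>y\<close>, the function \<open>\<phi>\<close> is the
  restriction of a holomorphic function of two complex variables.  This is real analyticity, in a
  form for which closure under products is immediate.
\<close>

definition complexifiable_on :: "(complex \<Rightarrow> complex) \<Rightarrow> complex set \<Rightarrow> bool" where
  "complexifiable_on \<phi> S \<longleftrightarrow> (\<forall>w\<in>S. \<exists>e>0. \<exists>\<Phi>. hol_on_curves \<Phi> e \<and>
     (\<forall>x y :: real. \<bar>x\<bar> < e \<and> \<bar>y\<bar> < e \<longrightarrow>
        \<phi> (w + Complex x y) = \<Phi> (of_real x) (of_real y)))"

lemma hol_on_curvesD:
  assumes "hol_on_curves \<Phi> e" "open U" "\<alpha> holomorphic_on U" "\<beta> holomorphic_on U"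
    "\<And>\<zeta>. \<zeta> \<in> U \<Longrightarrow> cmod (\<alpha> \<zeta>) < e" "\<And>\<zeta>. \<zeta> \<in> U \<Longrightarrow> cmod (\<beta> \<zeta>) < e"
  shows "(\<lambda>\<zeta>. \<Phi> (\<alpha> \<zeta>) (\<beta> \<zeta>)) holomorphic_on U"
  using assms unfolding hol_on_curves_def by (force simp: subset_iff)

lemma hol_on_curves_mono:
  assumes "hol_on_curves \<Phi> e" "d \<le> e"
  shows "hol_on_curves \<Phi> d"
proof -
  have "ball 0 d \<subseteq> ball (0::complex) e"
    using assms(2) by (rule subset_ball)
  then show ?thesis
    using assms(1) unfolding hol_on_curves_def by (meson subset_trans)
qed

lemma complexifiable_on_lift2:
  assumes "complexifiable_on \<phi> S" "complexifiable_on \<psi> S"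
    and op: "\<And>f g U. open U \<Longrightarrow> f holomorphic_on U \<Longrightarrow> g holomorphic_on U \<Longrightarrow>
      (\<lambda>z. c (f z) (g z)) holomorphic_on U"
  shows "complexifiable_on (\<lambda>z. c (\<phi> z) (\<psi> z)) S"
  unfolding complexifiable_on_def
proof
  fix w assume "w \<in> S"
  then obtain e \<Phi> e' \<Psi> where *: "e > 0" "hol_on_curves \<Phi> e"
      "\<And>x y :: real. \<bar>x\<bar> < e \<Longrightarrow> \<bar>y\<bar> < e \<Longrightarrow> \<phi> (w + Complex x y) = \<Phi> (of_real x) (of_real y)"
      "e' > 0" "hol_on_curves \<Psi> e'"
      "\<And>x y :: real. \<bar>x\<bar> < e' \<Longrightarrow> \<bar>y\<bar> < e' \<Longrightarrow> \<psi> (w + Complex x y) = \<Psi> (of_real x) (of_real y)"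
    using assms(1,2) unfolding complexifiable_on_def by meson
  have "hol_on_curves (\<lambda>X Y. c (\<Phi> X Y) (\<Psi> X Y)) (min e e')"
    using hol_on_curves_mono[OF *(2), of "min e e'"] hol_on_curves_mono[OF *(5), of "min e e'"] op
    unfolding hol_on_curves_def by simp
  then show "\<exists>e>0. \<exists>\<Phi>. hol_on_curves \<Phi> e \<and> (\<forall>x y. \<bar>x\<bar> < e \<and> \<bar>y\<bar> < e \<longrightarrow>
        c (\<phi> (w + Complex x y)) (\<psi> (w + Complex x y)) = \<Phi> (of_real x) (of_real y))"
    using * by (intro exI[of _ "min e e'"] conjI exI[of _ "\<lambda>X Y. c (\<Phi> X Y) (\<Psi> X Y)"]) auto
qed

lemma complexifiable_on_add:
  "complexifiable_on \<phi> S \<Longrightarrow> complexifiable_on \<psi> S \<Longrightarrow> complexifiable_on (\<lambda>z. \<phi> z + \<psi> z) S"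
  by (rule complexifiable_on_lift2) (auto intro: holomorphic_intros)

lemma complexifiable_on_mult:
  "complexifiable_on \<phi> S \<Longrightarrow> complexifiable_on \<psi> S \<Longrightarrow> complexifiable_on (\<lambda>z. \<phi> z * \<psi> z) S"
  by (rule complexifiable_on_lift2) (auto intro: holomorphic_intros)

lemma complexifiable_on_const: "complexifiable_on (\<lambda>z. c) S"
  unfolding complexifiable_on_def
  by (intro ballI exI[of _ 1] conjI exI[of _ "\<lambda>_ _. c"]) (auto simp: hol_on_curves_def)

lemma real_analytic_on_imp_complexifiable_on:
  assumes "real_analytic_on f S"
  shows "complexifiable_on f S"
  unfolding complexifiable_on_def
proof
  fix w assume "w \<in> S"
  then obtain e and c :: "nat \<Rightarrow> nat \<Rightarrow> complex" where e: "e > 0" and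
    sum: "\<And>z. z \<in> ball w e \<Longrightarrow>
      ((\<lambda>(m, n). c m n * complex_of_real (Re (z - w) ^ m * Im (z - w) ^ n)) has_sum f z) UNIV"
    using assms unfolding real_analytic_on_def by blast
  define \<rho> where "\<rho> = e / 2"
  have "\<rho> > 0" using e by (simp add: \<rho>_def)
  have ball: "w + Complex x y \<in> ball w e" if "\<bar>x\<bar> < \<rho>" "\<bar>y\<bar> < \<rho>" for x y
    using that cmod_le[of "Complex x y"] by (auto simp: dist_norm \<rho>_def)
  define T where "T = (\<lambda>p X Y. case p of (m :: nat, n :: nat) \<Rightarrow> c m n * X ^ m * Y ^ n)"
  define \<Phi> where "\<Phi> = (\<lambda>X Y. \<Sum>\<^sub>\<infinity>p. T p X Y)"
  have eq: "f (w + Complex x y) = \<Phi> (of_real x) (of_real y)" if "\<bar>x\<bar> < \<rho>" "\<bar>y\<bar> < \<rho>" for x y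
  proof -
    have "((\<lambda>p. T p (of_real x) (of_real y)) has_sum f (w + Complex x y)) UNIV"
      using sum[OF ball[OF that]] by (simp add: T_def case_prod_unfold mult.assoc)
    then show ?thesis
      by (simp add: \<Phi>_def infsumI)
  qed
  have "hol_on_curves \<Phi> (\<rho> / 2)"
    unfolding hol_on_curves_def
  proof (intro allI impI, elim conjE)
    fix U \<alpha> \<beta>
    assume U: "open U" "\<alpha> holomorphic_on U" "\<beta> holomorphic_on U"
      "\<alpha> ` U \<subseteq> ball 0 (\<rho> / 2)" "\<beta> ` U \<subseteq> ball 0 (\<rho> / 2)"
    have "(\<lambda>p. T p (of_real (\<rho> / 2)) (of_real (\<rho> / 2))) summable_on UNIV"
      using sum[OF ball[of "\<rho> / 2" "\<rho> / 2"]] \<open>\<rho> > 0\<close> 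
      by (auto simp: T_def case_prod_unfold mult.assoc intro: has_sum_imp_summable)
    then have M: "(\<lambda>p. cmod (T p (of_real (\<rho> / 2)) (of_real (\<rho> / 2)))) summable_on UNIV"
      by (simp add: summable_on_iff_abs_summable_on_complex)
    have le: "cmod (T p (\<alpha> \<zeta>) (\<beta> \<zeta>)) \<le> cmod (T p (of_real (\<rho> / 2)) (of_real (\<rho> / 2)))" if "\<zeta> \<in> U" for p \<zeta>
    proof -
      have "cmod (\<alpha> \<zeta>) \<le> \<rho> / 2" "cmod (\<beta> \<zeta>) \<le> \<rho> / 2"
        using U that by (auto simp: image_subset_iff)
      then show ?thesis using \<open>\<rho> > 0\<close>
        by (auto simp: T_def norm_mult norm_power case_prod_unfold norm_divide
              intro!: mult_mono power_mono)
    qed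
    have ul: "uniform_limit U (\<lambda>X \<zeta>. \<Sum>p\<in>X. T p (\<alpha> \<zeta>) (\<beta> \<zeta>)) (\<lambda>\<zeta>. \<Phi> (\<alpha> \<zeta>) (\<beta> \<zeta>))
        (finite_subsets_at_top UNIV)"
      unfolding \<Phi>_def by (rule Weierstrass_m_test_general[OF le M]) auto
    have hol: "(\<lambda>\<zeta>. \<Sum>p\<in>X. T p (\<alpha> \<zeta>) (\<beta> \<zeta>)) holomorphic_on U" for X
      using U by (auto simp: T_def case_prod_unfold intro!: holomorphic_intros)
    have loc: "\<exists>d>0. (\<lambda>\<zeta>. \<Phi> (\<alpha> \<zeta>) (\<beta> \<zeta>)) holomorphic_on ball z d" if z: "z \<in> U" for z
    proof -
      obtain d where d: "d > 0" "cball z d \<subseteq> U"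
        using z U(1) by (meson open_contains_cball)
      have d': "ball z d \<subseteq> U"
        using d by auto
      show ?thesis
      proof (rule holomorphic_uniform_limit)
        show "uniform_limit (cball z d) (\<lambda>X \<zeta>. \<Sum>p\<in>X. T p (\<alpha> \<zeta>) (\<beta> \<zeta>)) (\<lambda>\<zeta>. \<Phi> (\<alpha> \<zeta>) (\<beta> \<zeta>))
            (finite_subsets_at_top UNIV)"
          by (rule uniform_limit_on_subset[OF ul d(2)])
        show "\<forall>\<^sub>F X in finite_subsets_at_top UNIV.
            continuous_on (cball z d) (\<lambda>\<zeta>. \<Sum>p\<in>X. T p (\<alpha> \<zeta>) (\<beta> \<zeta>)) \<and>
            (\<lambda>\<zeta>. \<Sum>p\<in>X. T p (\<alpha> \<zeta>) (\<beta> \<zeta>)) holomorphic_on ball z d"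
          using holomorphic_on_subset[OF hol d(2)] holomorphic_on_subset[OF hol d']
          by (auto intro!: always_eventually holomorphic_on_imp_continuous_on)
      qed (use d(1) in auto)
    qed
    show "(\<lambda>\<zeta>. \<Phi> (\<alpha> \<zeta>) (\<beta> \<zeta>)) holomorphic_on U"
      unfolding holomorphic_on_def
    proof
      fix z assume "z \<in> U"
      then obtain d where "d > 0" "(\<lambda>\<zeta>. \<Phi> (\<alpha> \<zeta>) (\<beta> \<zeta>)) holomorphic_on ball z d"
        using loc by blast
      then have "(\<lambda>\<zeta>. \<Phi> (\<alpha> \<zeta>) (\<beta> \<zeta>)) field_differentiable at z"
        by (intro holomorphic_on_imp_differentiable_at[OF _ open_ball]) auto
      then show "(\<lambda>\<zeta>. \<Phi> (\<alpha> \<zeta>) (\<beta> \<zeta>)) field_differentiable at z within U"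
        by (rule field_differentiable_at_within)
    qed
  qed
  then show "\<exists>e>0. \<exists>\<Phi>. hol_on_curves \<Phi> e \<and> (\<forall>x y. \<bar>x\<bar> < e \<and> \<bar>y\<bar> < e \<longrightarrow>
        f (w + Complex x y) = \<Phi> (of_real x) (of_real y))"
    using eq \<open>\<rho> > 0\<close> by (intro exI[of _ "\<rho>/2"] conjI exI[of _ \<Phi>]) auto
qed

lemma holomorphic_eq_on_reals:
  fixes x0 d :: real
  assumes "f holomorphic_on ball (of_real x0) d" "g holomorphic_on ball (of_real x0) d"
    and eq: "\<And>x :: real. \<bar>x - x0\<bar> < d \<Longrightarrow> f (of_real x) = g (of_real x)"
    and z: "z \<in> ball (of_real x0) d"
  shows "f z = g z"
proof -
  have d: "d > 0"
    using z zero_le_dist[of "of_real x0" z] unfolding mem_ball by linarith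
  let ?U = "complex_of_real ` {x0 - d<..<x0 + d}"
  have "x0 islimpt {x0 - d<..<x0 + d}"
    using d by (intro interior_limit_point) simp
  then have lim: "complex_of_real x0 islimpt ?U"
    by (rule islimpt_isCont_image) (auto simp: eventually_at_filter)
  have "f z - g z = 0"
  proof (rule analytic_continuation[of "\<lambda>z. f z - g z" _ ?U "of_real x0"])
    show "(\<lambda>z. f z - g z) holomorphic_on ball (of_real x0) d"
      using assms by (intro holomorphic_intros)
    show "?U \<subseteq> ball (complex_of_real x0) d"
      by (auto simp: dist_norm simp flip: of_real_diff)
    show "\<And>z. z \<in> ?U \<Longrightarrow> f z - g z = 0"
      using eq by auto
  qed (use d z lim in auto)
  then show ?thesis by simp
qed

text \<open>
  In the variables \<open>Z = X + iY\<close>, \<open>W = X - iY\<close>, holomorphy of \<open>\<phi>\<close> says that its complexification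
  does not depend on \<open>W\<close>.  The identity theorem, used in one variable at a time, carries this from
  a small bidisc to the whole one.
\<close>

lemma holomorphic_spreads_in_ball:
  assumes \<Phi>: "hol_on_curves \<Phi> e"
    and \<phi>: "\<And>x y :: real. \<bar>x\<bar> < e \<Longrightarrow> \<bar>y\<bar> < e \<Longrightarrow> \<phi> (w + Complex x y) = \<Phi> (of_real x) (of_real y)"
    and U: "open U" "U \<inter> ball w e \<noteq> {}" "\<phi> holomorphic_on U"
  shows "\<phi> holomorphic_on ball w e"
proof -
  obtain p where p: "p \<in> U" "p \<in> ball w e"
    using U(2) by blast
  define z0 where "z0 = p - w"
  have z0: "cmod z0 < e"
    using p by (simp add: z0_def dist_norm norm_minus_commute)
  obtain d0 where d0: "d0 > 0" "ball p d0 \<subseteq> U"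
    using p U(1) openE by blast
  define d where "d = min (d0 / 2) (e - cmod z0)"
  have d: "d > 0" "2 * d \<le> d0" "d \<le> e - cmod z0"
    using d0 z0 by (auto simp: d_def min_def)
  have e: "e > 0"
    using z0 norm_ge_zero[of z0] by linarith
  define k where "k = (\<lambda>Z. \<phi> (w + Z))"
  have k: "k holomorphic_on ball z0 d0"
    unfolding k_def
  proof (rule holomorphic_on_compose_gen[of "\<lambda>Z. w + Z" _ \<phi> U, unfolded o_def])
    show "(\<lambda>Z. w + Z) ` ball z0 d0 \<subseteq> U"
      using d0 by (auto simp: z0_def dist_norm subset_iff algebra_simps)
  qed (use U in \<open>auto intro!: holomorphic_intros\<close>)
  have re: "\<bar>Re z0\<bar> \<le> cmod z0" "\<bar>Im z0\<bar> \<le> cmod z0"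
    by (simp_all add: abs_Re_le_cmod abs_Im_le_cmod)
  have smallX: "cmod X < e" if "X \<in> ball (of_real (Re z0)) d" for X
    using that re(1) d(3) norm_triangle_sub[of X "of_real (Re z0)"]
    unfolding mem_ball dist_norm norm_minus_commute[of _ X] norm_of_real by linarith
  have smallY: "cmod Y < e" if "Y \<in> ball (of_real (Im z0)) d" for Y
    using that re(2) d(3) norm_triangle_sub[of Y "of_real (Im z0)"]
    unfolding mem_ball dist_norm norm_minus_commute[of _ Y] norm_of_real by linarith
  have near: "X + \<i> * Y \<in> ball z0 d0"
    if "X \<in> ball (of_real (Re z0)) d" "Y \<in> ball (of_real (Im z0)) d" for X Y
  proof -
    have "z0 - (X + \<i> * Y) = (of_real (Re z0) - X) + \<i> * (of_real (Im z0) - Y)"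
      by (simp add: complex_eq_iff)
    also have "cmod \<dots> \<le> cmod (of_real (Re z0) - X) + cmod (of_real (Im z0) - Y)"
      using norm_triangle_ineq[of "of_real (Re z0) - X" "\<i> * (of_real (Im z0) - Y)"]
      by (simp add: norm_mult)
    finally show ?thesis
      using that d by (auto simp: dist_norm)
  qed
  have real: "\<Phi> (of_real x) (of_real y) = k (of_real x + \<i> * of_real y)"
    if "\<bar>x\<bar> < e" "\<bar>y\<bar> < e" for x y
    using \<phi>[OF that] by (simp add: k_def Complex_eq)
  have step1: "\<Phi> X (of_real y) = k (X + \<i> * of_real y)"
    if X: "X \<in> ball (of_real (Re z0)) d" and y: "\<bar>y - Im z0\<bar> < d" for X and y :: real
  proof (rule holomorphic_eq_on_reals[OF _ _ _ X])
    have y': "of_real y \<in> ball (complex_of_real (Im z0)) d"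
      using y by (simp add: dist_norm abs_minus_commute flip: of_real_diff)
    show "(\<lambda>X. \<Phi> X (of_real y)) holomorphic_on ball (of_real (Re z0)) d"
      by (rule hol_on_curvesD[OF \<Phi>]) (use smallX smallY[OF y'] in \<open>auto intro!: holomorphic_intros\<close>)
    show "(\<lambda>X. k (X + \<i> * of_real y)) holomorphic_on ball (of_real (Re z0)) d"
      by (rule holomorphic_on_compose_gen[of "\<lambda>X. X + \<i> * of_real y", OF _ k, unfolded o_def])
         (use near y' in \<open>auto intro!: holomorphic_intros\<close>)
    fix x :: real assume "\<bar>x - Re z0\<bar> < d"
    then have "of_real x \<in> ball (complex_of_real (Re z0)) d"
      by (simp add: dist_norm abs_minus_commute flip: of_real_diff)
    from smallX[OF this] smallY[OF y'] show "\<Phi> (of_real x) (of_real y) = k (of_real x + \<i> * of_real y)"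
      by (intro real) auto
  qed
  have step2: "\<Phi> X Y = k (X + \<i> * Y)"
    if X: "X \<in> ball (of_real (Re z0)) d" and Y: "Y \<in> ball (of_real (Im z0)) d" for X Y
  proof (rule holomorphic_eq_on_reals[OF _ _ _ Y])
    show "(\<lambda>Y. \<Phi> X Y) holomorphic_on ball (of_real (Im z0)) d"
      by (rule hol_on_curvesD[OF \<Phi>]) (use smallX[OF X] smallY in \<open>auto intro!: holomorphic_intros\<close>)
    show "(\<lambda>Y. k (X + \<i> * Y)) holomorphic_on ball (of_real (Im z0)) d"
      by (rule holomorphic_on_compose_gen[of "\<lambda>Y. X + \<i> * Y", OF _ k, unfolded o_def])
         (use near X in \<open>auto intro!: holomorphic_intros\<close>)
  qed (use step1[OF X] in auto)
  \<comment> \<open>the complexification in the variables \<open>Z = X + iY\<close>, \<open>W = X - iY\<close>\<close>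
  define E where "E = (\<lambda>Z W. \<Phi> ((Z + W) / 2) (\<i> * (W - Z) / 2))"
  have half: "cmod ((Z + W) / 2) < r" "cmod (\<i> * (W - Z) / 2) < r"
    if "cmod Z < r" "cmod W < r" for Z W r
  proof -
    have "cmod (Z + W) < r * 2" "cmod (W - Z) < r * 2"
      using that norm_triangle_ineq[of Z W] norm_triangle_ineq4[of W Z] by linarith+
    then show "cmod ((Z + W) / 2) < r" "cmod (\<i> * (W - Z) / 2) < r"
      by (simp_all only: norm_divide norm_mult norm_numeral norm_ii)
  qed
  have E1: "E Z W = k Z" if "Z \<in> ball z0 d" "W \<in> ball (cnj z0) d" for Z W
  proof -
    have eqs: "of_real (Re z0) - (Z + W) / 2 = ((z0 - Z) + (cnj z0 - W)) / 2"
      "of_real (Im z0) - \<i> * (W - Z) / 2 = \<i> * ((cnj z0 - W) - (z0 - Z)) / 2"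
      "(Z + W) / 2 + \<i> * (\<i> * (W - Z) / 2) = Z"
      by (simp_all add: complex_eq_iff field_simps)
    have "cmod (z0 - Z) < d" "cmod (cnj z0 - W) < d"
      using that by (simp_all add: dist_norm)
    from half[OF this] have "\<Phi> ((Z + W) / 2) (\<i> * (W - Z) / 2) = k ((Z + W) / 2 + \<i> * (\<i> * (W - Z) / 2))"
      by (intro step2) (simp_all only: mem_ball dist_norm eqs)
    then show ?thesis
      unfolding E_def eqs .
  qed
  have E2: "E Z W = k Z" if Z: "Z \<in> ball z0 d" and W: "W \<in> ball 0 e" for Z W
  proof (rule analytic_continuation_open[of "ball (cnj z0) d" "ball 0 e" "E Z" "\<lambda>_. k Z"])
    have "cmod Z < e"
      using Z d norm_triangle_sub[of Z z0] by (auto simp: dist_norm norm_minus_commute)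
    then show "E Z holomorphic_on ball 0 e"
      unfolding E_def using half[of Z e]
      by (intro hol_on_curvesD[OF \<Phi>]) (auto intro!: holomorphic_intros)
    show "ball (cnj z0) d \<subseteq> ball 0 e"
      using d by (simp add: ball_subset_ball_iff dist_norm)
  qed (use E1 Z W d in auto)
  have sub: "ball z0 d \<subseteq> ball 0 e"
    using d by (simp add: ball_subset_ball_iff dist_norm)
  have E3: "E Z W = E Z 0" if Z: "Z \<in> ball 0 e" and W: "W \<in> ball 0 e" for Z W
  proof (rule analytic_continuation_open[of "ball z0 d" "ball 0 e" "\<lambda>Z. E Z W" "\<lambda>Z. E Z 0"])
    show "(\<lambda>Z. E Z W) holomorphic_on ball 0 e" "(\<lambda>Z. E Z 0) holomorphic_on ball 0 e"
      unfolding E_def using half[of _ e W] half[of _ e 0] W e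
      by (auto intro!: holomorphic_intros hol_on_curvesD[OF \<Phi>])
  qed (use E2 W Z d sub e in auto)
  have main: "\<phi> p = E (p - w) 0" if p: "p \<in> ball w e" for p
  proof -
    have n: "cmod (p - w) < e"
      using p by (simp add: dist_norm norm_minus_commute)
    \<comment> \<open>real points are those with \<open>W = cnj Z\<close>\<close>
    have "E (p - w) (cnj (p - w)) = \<Phi> (of_real (Re (p - w))) (of_real (Im (p - w)))"
      unfolding E_def by (intro arg_cong2[of _ _ _ _ \<Phi>]) (auto simp: complex_eq_iff)
    also have "\<dots> = \<phi> (w + Complex (Re (p - w)) (Im (p - w)))"
      using n abs_Re_le_cmod[of "p - w"] abs_Im_le_cmod[of "p - w"] by (intro \<phi>[symmetric]) linarith+
    also have "\<dots> = \<phi> p"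
      by (simp only: complex.collapse) simp
    finally show ?thesis
      using E3[of "p - w" "cnj (p - w)"] n by (simp only: mem_ball_0 complex_mod_cnj)
  qed
  have "(\<lambda>p. E (p - w) 0) holomorphic_on ball w e"
    unfolding E_def using half[of _ e 0] e
    by (intro hol_on_curvesD[OF \<Phi>])
       (auto intro!: holomorphic_intros simp: dist_norm norm_minus_commute)
  then show ?thesis
    by (rule holomorphic_transform) (use main in auto)
qed

text \<open>
  Hence a real analytic function on a connected open set that is holomorphic somewhere is
  holomorphic everywhere.
\<close>

lemma complexifiable_on_holomorphic:
  assumes \<phi>: "complexifiable_on \<phi> S" and S: "open S" "connected S"
    and U: "open U" "U \<noteq> {}" "U \<subseteq> S" "\<phi> holomorphic_on U"
  shows "\<phi> holomorphic_on S"
proof -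
  define C where "C = {W. open W \<and> W \<subseteq> S \<and> \<phi> holomorphic_on W}"
  define V where "V = (\<Union>W\<in>C. W)"
  have V: "open V" "V \<subseteq> S" "U \<subseteq> V"
    using U unfolding V_def C_def by blast+
  have holV: "\<phi> holomorphic_on V"
    unfolding V_def by (rule holomorphic_on_UN_open) (simp_all add: C_def)
  have near: "\<exists>d>0. ball w d \<subseteq> S \<and> (ball w d \<inter> V = {} \<or> ball w d \<subseteq> V)" if "w \<in> S" for w
  proof -
    obtain e \<Phi> where *: "e > 0" "hol_on_curves \<Phi> e"
      "\<And>x y :: real. \<bar>x\<bar> < e \<Longrightarrow> \<bar>y\<bar> < e \<Longrightarrow> \<phi> (w + Complex x y) = \<Phi> (of_real x) (of_real y)"
      using \<phi> \<open>w \<in> S\<close> unfolding complexifiable_on_def by meson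
    obtain d where d: "d > 0" "ball w d \<subseteq> S"
      using \<open>w \<in> S\<close> \<open>open S\<close> openE by blast
    define r where "r = min d e"
    have r: "r > 0" "ball w r \<subseteq> S"
      using d *(1) subset_ball[of r d w] by (auto simp: r_def)
    have "ball w r \<subseteq> V" if "ball w r \<inter> V \<noteq> {}"
    proof -
      have "\<phi> holomorphic_on ball w r"
        by (rule holomorphic_spreads_in_ball[where \<Phi> = \<Phi> and U = V])
           (use that V(1) holV *(3) hol_on_curves_mono[OF *(2), of r] in \<open>auto simp: r_def\<close>)
      then show ?thesis
        using r unfolding V_def C_def by blast
    qed
    then show ?thesis
      using r by blast
  qed
  have "open (S - V)"
  proof (intro openI)
    fix w assume w: "w \<in> S - V"
    then obtain d where d: "d > 0" "ball w d \<subseteq> S" "ball w d \<inter> V = {} \<or> ball w d \<subseteq> V"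
      using near by blast
    then have "ball w d \<inter> V = {}"
      using w by (metis DiffD2 centre_in_ball subsetD)
    then show "\<exists>d>0. ball w d \<subseteq> S - V"
      using d by blast
  qed
  moreover have "V \<inter> (S - V) = {}" "S \<subseteq> V \<union> (S - V)" "V \<inter> S \<noteq> {}"
    using U V by auto
  ultimately have "(S - V) \<inter> S = {}"
    using connectedD[OF S(2) V(1)] by blast
  then have "V = S"
    using V(2) by auto
  then show ?thesis
    using holV by simp
qed

lemma complexifiable_on_subset:
  "complexifiable_on \<phi> S \<Longrightarrow> T \<subseteq> S \<Longrightarrow> complexifiable_on \<phi> T"
  unfolding complexifiable_on_def by blast

section \<open>The functions z to the r times zbar to the s\<close>

lemma complexifiable_on_cpow:
  fixes c :: real
  assumes c: "\<bar>c\<bar> = 1"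
  shows "complexifiable_on (\<lambda>z. cpow r s (a + of_real c * z)) {z. a + of_real c * z \<noteq> 0}"
  unfolding complexifiable_on_def
proof
  fix w assume "w \<in> {z. a + of_real c * z \<noteq> 0}"
  define v where "v = a + of_real c * w"
  have v: "v \<noteq> 0"
    using \<open>w \<in> _\<close> by (simp add: v_def)
  define e where "e = cmod v / 2"
  have e: "e > 0"
    using v by (simp add: e_def)
  \<comment> \<open>For real \<open>x\<close>, \<open>y\<close> and \<open>u = c (x + iy)\<close>, the squared modulus of \<open>v + u\<close> is
    \<open>|v|^2 (1 + u / v) (1 + c (x - iy) / cnj v)\<close>, and both factors have holomorphic logarithms for
    small complex \<open>x\<close> and \<open>y\<close>.\<close>
  define \<Phi> where "\<Phi> = (\<lambda>X Y. (v + of_real c * (X + \<i> * Y)) powi \<lfloor>r - s\<rfloor> * of_real ((cmod v)\<^sup>2 powr s)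
    * exp (of_real s * (Ln (1 + of_real c * (X + \<i> * Y) / v) + Ln (1 + of_real c * (X - \<i> * Y) / cnj v))))"
  have lt: "cmod (of_real c * (X + \<i> * Y)) < cmod v" "cmod (of_real c * (X - \<i> * Y)) < cmod v"
    if "cmod X < e" "cmod Y < e" for X Y
  proof -
    have "cmod (X + \<i> * Y) \<le> cmod X + cmod Y" "cmod (X - \<i> * Y) \<le> cmod X + cmod Y"
      using norm_triangle_ineq[of X "\<i> * Y"] norm_triangle_ineq4[of X "\<i> * Y"] by (simp_all add: norm_mult)
    then show "cmod (of_real c * (X + \<i> * Y)) < cmod v" "cmod (of_real c * (X - \<i> * Y)) < cmod v"
      using that c by (simp_all add: norm_mult e_def)
  qed
  have nonpos: "1 + z \<notin> \<real>\<^sub>\<le>\<^sub>0" if "cmod z < 1" for z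
  proof
    assume "1 + z \<in> \<real>\<^sub>\<le>\<^sub>0"
    then have "Re (1 + z) \<le> 0"
      by (auto simp: complex_nonpos_Reals_iff)
    then show False
      using that abs_Re_le_cmod[of z] by auto
  qed
  have "hol_on_curves \<Phi> e"
    unfolding hol_on_curves_def
  proof (intro allI impI, elim conjE)
    fix U \<alpha> \<beta>
    assume U: "open U" "\<alpha> holomorphic_on U" "\<beta> holomorphic_on U"
      "\<alpha> ` U \<subseteq> ball 0 e" "\<beta> ` U \<subseteq> ball 0 e"
    have *: "cmod (of_real c * (\<alpha> \<zeta> + \<i> * \<beta> \<zeta>)) < cmod v" "cmod (of_real c * (\<alpha> \<zeta> - \<i> * \<beta> \<zeta>)) < cmod v"
      if "\<zeta> \<in> U" for \<zeta>
      using lt[of "\<alpha> \<zeta>" "\<beta> \<zeta>"] U(4,5) that by (auto simp: image_subset_iff)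
    have 0: "v + of_real c * (\<alpha> \<zeta> + \<i> * \<beta> \<zeta>) \<noteq> 0" if "\<zeta> \<in> U" for \<zeta>
      using *(1)[OF that] by (metis add_eq_0_iff norm_minus_cancel less_irrefl)
    have 1: "1 + of_real c * (\<alpha> \<zeta> + \<i> * \<beta> \<zeta>) / v \<notin> \<real>\<^sub>\<le>\<^sub>0" if "\<zeta> \<in> U" for \<zeta>
      using *(1)[OF that] v by (intro nonpos) (simp add: norm_divide)
    have 2: "1 + of_real c * (\<alpha> \<zeta> - \<i> * \<beta> \<zeta>) / cnj v \<notin> \<real>\<^sub>\<le>\<^sub>0" if "\<zeta> \<in> U" for \<zeta>
      using *(2)[OF that] v by (intro nonpos) (simp add: norm_divide)
    show "(\<lambda>\<zeta>. \<Phi> (\<alpha> \<zeta>) (\<beta> \<zeta>)) holomorphic_on U"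
      unfolding \<Phi>_def
      by (intro holomorphic_intros U(2,3) 0 1 2) (use v 0 in auto)
  qed
  moreover have "cpow r s (a + of_real c * (w + Complex x y)) = \<Phi> (of_real x) (of_real y)"
    if "\<bar>x\<bar> < e" "\<bar>y\<bar> < e" for x y :: real
  proof -
    define u where "u = of_real c * (of_real x + \<i> * of_real y)"
    have u: "cmod u < cmod v" "cnj u = of_real c * (of_real x - \<i> * of_real y)"
      using lt(1)[of "of_real x" "of_real y"] that by (simp_all add: u_def)
    define A where "A = u / v"
    have A: "cmod A < 1" "cnj A = cnj u / cnj v" "v + u = v * (1 + A)"
      using u(1) v by (auto simp: A_def norm_divide field_simps)
    have A1: "1 + A \<noteq> 0"
      using A(1) by (metis add_eq_0_iff norm_minus_cancel norm_one less_irrefl)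
    have "Ln (1 + cnj A) = cnj (Ln (1 + A))"
      using cnj_Ln[OF nonpos[OF A(1)]] by simp
    then have "Ln (1 + A) + Ln (1 + cnj A) = of_real (2 * ln (cmod (1 + A)))"
      using A1 by (simp add: complex_add_cnj)
    then have "exp (of_real s * (Ln (1 + A) + Ln (1 + cnj A))) = of_real ((cmod (1 + A))\<^sup>2 powr s)"
      using A1 by (simp add: powr_def ln_realpow mult_ac flip: exp_of_real)
    then have "cpow r s (v + u) = (v + u) powi \<lfloor>r - s\<rfloor> * of_real ((cmod v)\<^sup>2 powr s)
        * exp (of_real s * (Ln (1 + A) + Ln (1 + cnj A)))"
      by (simp add: cpow_def A(3) norm_mult power_mult_distrib powr_mult)
    moreover have "a + of_real c * (w + Complex x y) = v + u"
      by (simp add: v_def u_def Complex_eq algebra_simps)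
    ultimately show ?thesis
      unfolding \<Phi>_def A(2) u(2) by (simp only: A_def u_def)
  qed
  ultimately show "\<exists>e>0. \<exists>\<Phi>. hol_on_curves \<Phi> e \<and> (\<forall>x y. \<bar>x\<bar> < e \<and> \<bar>y\<bar> < e \<longrightarrow>
      cpow r s (a + of_real c * (w + Complex x y)) = \<Phi> (of_real x) (of_real y))"
    using e by blast
qed

lemma cpow_mult: "cpow r s (x * y) = cpow r s x * cpow r s y"
  by (simp add: cpow_def power_int_mult_distrib norm_mult power_mult_distrib powr_mult)

lemma cpow_add:
  assumes "r - s \<in> \<int>" "z \<noteq> 0"
  shows "cpow (r + r') (s + s') z = cpow r s z * cpow r' s' z"
proof -
  obtain n where n: "r - s = of_int n"
    using assms(1) by (auto elim: Ints_cases)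
  have "r + r' - (s + s') = of_int n + (r' - s')"
    using n by simp
  then have "\<lfloor>r + r' - (s + s')\<rfloor> = n + \<lfloor>r' - s'\<rfloor>"
    by (metis add.commute floor_add_int)
  then show ?thesis
    using assms(2) n by (simp add: cpow_def power_int_add powr_add)
qed

lemma cpow_0_0: "z \<noteq> 0 \<Longrightarrow> cpow 0 0 z = 1"
  by (simp add: cpow_def)

lemma cpow_one [simp]: "cpow r s 1 = 1"
  by (simp add: cpow_def)

lemma cpow_minus_one: "cpow r s (- 1) = (- 1) powi \<lfloor>r - s\<rfloor>"
  by (simp add: cpow_def)

lemma cpow_minus: "cpow r s (- z) = (- 1) powi \<lfloor>r - s\<rfloor> * cpow r s z"
  using cpow_mult[of r s "- 1" z] by (simp add: cpow_minus_one)

lemma cpow_of_int: "z \<noteq> 0 \<Longrightarrow> cpow (of_int m) 0 z = z powi m"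
  by (simp add: cpow_def)

lemma cpow_of_nat:
  assumes "z \<noteq> 0"
  shows "cpow (of_nat m) (of_nat n) z = z ^ m * cnj z ^ n"
proof -
  have "\<lfloor>real m - real n\<rfloor> = int m - int n"
    by (metis floor_of_int of_int_diff of_int_of_nat_eq)
  moreover have "complex_of_real ((cmod z)\<^sup>2 powr real n) = z ^ n * cnj z ^ n"
    using assms by (simp add: powr_realpow flip: power_mult_distrib complex_norm_square)
  ultimately have "cpow (of_nat m) (of_nat n) z = z powi (int m - int n) * z powi (int n) * cnj z ^ n"
    by (simp add: cpow_def)
  also have "z powi (int m - int n) * z powi (int n) = z powi (int m)"
    using assms power_int_add[of z "int m - int n" "int n"] by simp
  finally show ?thesis by simp
qed

lemma cpow_eq_powr:
  assumes "\<alpha> - \<beta> \<in> \<int>" "Re u > 0"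
  shows "cpow \<alpha> \<beta> u = u powr of_real \<alpha> * cnj u powr of_real \<beta>"
proof -
  obtain n where n: "\<alpha> - \<beta> = of_int n"
    using assms(1) by (auto elim: Ints_cases)
  have u: "u \<noteq> 0" "u \<notin> \<real>\<^sub>\<le>\<^sub>0"
    using assms(2) by (auto simp: complex_nonpos_Reals_iff)
  have "Ln u + cnj (Ln u) = of_real (2 * ln (cmod u))"
    using u by (simp add: complex_add_cnj)
  then have "of_real ((cmod u)\<^sup>2 powr \<beta>) = exp (of_real \<beta> * (Ln u + cnj (Ln u)))"
    using u by (simp add: powr_def ln_realpow mult_ac flip: exp_of_real)
  moreover have "u powi n = exp (of_int n * Ln u)"
    using u exp_power_int[of "Ln u" n] by simp
  moreover have "of_real \<alpha> = of_int n + (of_real \<beta> :: complex)"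
    using n by (metis diff_add_cancel of_real_add of_real_of_int_eq)
  ultimately show ?thesis
    using n u by (simp add: cpow_def powr_def cnj_Ln exp_add[symmetric] algebra_simps)
qed

section \<open>Convergent expansions in real powers\<close>

text \<open>
  Pointwise convergence of the series \<open>a\<close> to \<open>g\<close> on a punctured disc.  The sums are unordered, so
  convergence is absolute.
\<close>

definition expands :: "(real \<Rightarrow> real \<Rightarrow> complex) \<Rightarrow> (complex \<Rightarrow> complex) \<Rightarrow> bool" where
  "expands a g \<longleftrightarrow> (\<exists>R>0. \<forall>q. 0 < cmod q \<and> cmod q < R \<longrightarrow>
     ((\<lambda>(r, s). a r s * cpow r s q) has_sum g q) UNIV)"

lemma conf_converges_imp_expands:
  assumes "conf_converges a g"
  shows "expands a g"
proof -
  obtain R where R: "R > 0" "\<And>K. compact K \<Longrightarrow> K \<subseteq> ball 0 R - {0} \<Longrightarrow>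
      uniform_limit K (\<lambda>X q. \<Sum>(r, s)\<in>X. a r s * cpow r s q) g (finite_subsets_at_top UNIV)"
    using assms unfolding conf_converges_def by blast
  have "((\<lambda>(r, s). a r s * cpow r s q) has_sum g q) UNIV" if "0 < cmod q" "cmod q < R" for q
    using R(2)[of "{q}"] that unfolding has_sum_def by (auto simp: case_prod_unfold)
  then show ?thesis
    using R(1) unfolding expands_def by blast
qed

lemma expands_cong:
  assumes "expands a g" "R > 0" "\<And>q. 0 < cmod q \<Longrightarrow> cmod q < R \<Longrightarrow> g q = g' q"
  shows "expands a g'"
proof -
  obtain R' where R': "R' > 0" "\<And>q. 0 < cmod q \<Longrightarrow> cmod q < R' \<Longrightarrow>
      ((\<lambda>(r, s). a r s * cpow r s q) has_sum g q) UNIV"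
    using assms(1) unfolding expands_def by blast
  have "((\<lambda>(r, s). a r s * cpow r s q) has_sum g' q) UNIV" if "0 < cmod q" "cmod q < min R R'" for q
    using R'(2)[of q] assms(3)[of q] that by simp
  then show ?thesis
    unfolding expands_def using R'(1) assms(2) by (intro exI[of _ "min R R'"]) auto
qed

lemma expands_0: "expands (\<lambda>r s. 0) (\<lambda>q. 0)"
  unfolding expands_def by (intro exI[of _ 1]) (auto simp: case_prod_unfold)

lemma expands_add:
  assumes "expands a g" "expands b h"
  shows "expands (\<lambda>r s. a r s + b r s) (\<lambda>q. g q + h q)"
proof -
  obtain R where R: "R > 0" "\<And>q. 0 < cmod q \<Longrightarrow> cmod q < R \<Longrightarrow>
      ((\<lambda>(r, s). a r s * cpow r s q) has_sum g q) UNIV"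
    using assms(1) unfolding expands_def by blast
  obtain R' where R': "R' > 0" "\<And>q. 0 < cmod q \<Longrightarrow> cmod q < R' \<Longrightarrow>
      ((\<lambda>(r, s). b r s * cpow r s q) has_sum h q) UNIV"
    using assms(2) unfolding expands_def by blast
  show ?thesis
    unfolding expands_def
    using R(1) R'(1) has_sum_add[OF R(2) R'(2)]
    by (intro exI[of _ "min R R'"]) (auto simp: case_prod_unfold algebra_simps)
qed

lemma expands_cmult:
  assumes "expands a g"
  shows "expands (\<lambda>r s. k * a r s) (\<lambda>q. k * g q)"
proof -
  obtain R where R: "R > 0" "\<And>q. 0 < cmod q \<Longrightarrow> cmod q < R \<Longrightarrow>
      ((\<lambda>(r, s). a r s * cpow r s q) has_sum g q) UNIV"
    using assms(1) unfolding expands_def by blast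
  show ?thesis
    unfolding expands_def
    using R(1) has_sum_cmult_right[OF R(2), of _ k]
    by (intro exI[of _ R]) (auto simp: case_prod_unfold algebra_simps)
qed

lemma expands_shift:
  assumes "expands a g" "\<alpha> - \<beta> \<in> \<int>"
  shows "expands (\<lambda>r s. a (r - \<alpha>) (s - \<beta>)) (\<lambda>q. cpow \<alpha> \<beta> q * g q)"
proof -
  obtain R where R: "R > 0" "\<And>q. 0 < cmod q \<Longrightarrow> cmod q < R \<Longrightarrow>
      ((\<lambda>(r, s). a r s * cpow r s q) has_sum g q) UNIV"
    using assms(1) unfolding expands_def by blast
  have "((\<lambda>(r, s). a (r - \<alpha>) (s - \<beta>) * cpow r s q) has_sum cpow \<alpha> \<beta> q * g q) UNIV"
    if q: "0 < cmod q" "cmod q < R" for q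
  proof -
    have "((\<lambda>(r, s). a r s * cpow (\<alpha> + r) (\<beta> + s) q) has_sum cpow \<alpha> \<beta> q * g q) UNIV"
      using has_sum_cmult_right[OF R(2)[OF q], of "cpow \<alpha> \<beta> q"] q assms(2)
      by (simp add: cpow_add case_prod_unfold mult_ac)
    also have "?this \<longleftrightarrow> ?thesis"
      by (rule has_sum_reindex_bij_witness[of _ "\<lambda>(r, s). (r - \<alpha>, s - \<beta>)" "\<lambda>(r, s). (r + \<alpha>, s + \<beta>)"])
         (auto simp: add.commute)
    finally show ?thesis .
  qed
  then show ?thesis
    using R(1) unfolding expands_def by blast
qed

lemma has_sum_times:
  fixes f :: "'i \<Rightarrow> complex" and g :: "'j \<Rightarrow> complex"
  assumes "(f has_sum x) A" "(g has_sum y) B"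
  shows "((\<lambda>(i, j). f i * g j) has_sum (x * y)) (A \<times> B)"
proof (rule has_sum_SigmaI)
  show "((\<lambda>j. case (i, j) of (i, j) \<Rightarrow> f i * g j) has_sum f i * y) B" for i
    using has_sum_cmult_right[OF assms(2)] by simp
  show "((\<lambda>i. f i * y) has_sum x * y) A"
    by (rule has_sum_cmult_left[OF assms(1)])
  have "(\<lambda>i. cmod (f i)) summable_on A" "(\<lambda>j. cmod (g j)) summable_on B"
    using assms by (auto dest!: has_sum_imp_summable simp: summable_on_iff_abs_summable_on_complex)
  then obtain X Y where XY: "((\<lambda>i. cmod (f i)) has_sum X) A" "((\<lambda>j. cmod (g j)) has_sum Y) B"
    by (auto simp: summable_on_def)
  have "(\<lambda>(i, j). cmod (f i) * cmod (g j)) summable_on (A \<times> B)"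
    by (rule summable_on_SigmaI[where g = "\<lambda>i. cmod (f i) * Y"])
       (use XY has_sum_cmult_right[OF XY(2)] has_sum_cmult_left[OF XY(1)] in \<open>auto intro: has_sum_imp_summable\<close>)
  then show "(\<lambda>(i, j). f i * g j) summable_on (A \<times> B)"
    by (subst summable_on_iff_abs_summable_on_complex) (simp add: case_prod_unfold norm_mult)
qed

lemma has_sum_Sum_any:
  assumes "finite {x. f x \<noteq> 0}"
  shows "(f has_sum Sum_any f) UNIV"
  by (rule has_sum_finite_neutralI[OF assms]) (auto simp: Sum_any.expand_set)

lemma of_real_gbinomial: "complex_of_real (a gchoose n) = of_real a gchoose n"
  by (simp add: gbinomial_prod_rev)

lemma has_sum_gbinomial:
  fixes z :: complex
  assumes "cmod z < 1"
  shows "((\<lambda>n. (a gchoose n) * z ^ n) has_sum (1 + z) powr a) UNIV"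
proof (rule norm_summable_imp_has_sum)
  show "(\<lambda>n. (a gchoose n) * z ^ n) sums (1 + z) powr a"
    by (rule gen_binomial_complex[OF assms])
  obtain t where t: "cmod z < t" "t < 1"
    using assms dense by blast
  have "0 \<le> t"
    using t norm_ge_zero[of z] by linarith
  then have "cmod (of_real t) < 1"
    using t by simp
  from sums_summable[OF gen_binomial_complex[OF this]]
  have "summable (\<lambda>n. (a gchoose n) * of_real t ^ n)" .
  from powser_insidea[OF this, of z] show "summable (\<lambda>n. norm ((a gchoose n) * z ^ n))"
    using t \<open>0 \<le> t\<close> by simp
qed

lemma has_sum_binomial_cpow:
  assumes "\<alpha> - \<beta> \<in> \<int>" "\<epsilon> = 1 \<or> \<epsilon> = - 1" "cmod q < 1"
  shows "((\<lambda>(m, n). complex_of_real (\<alpha> gchoose m) * complex_of_real (\<beta> gchoose n) * \<epsilon> ^ (m + n)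
            * (q ^ m * cnj q ^ n)) has_sum cpow \<alpha> \<beta> (1 + \<epsilon> * q)) UNIV"
proof -
  have n: "cmod (\<epsilon> * q) < 1" "cmod (\<epsilon> * cnj q) < 1"
    using assms(2,3) by (auto simp: norm_mult)
  have "Re (1 + \<epsilon> * q) > 0"
    using n(1) abs_Re_le_cmod[of "\<epsilon> * q"] by auto
  moreover have "cnj (1 + \<epsilon> * q) = 1 + \<epsilon> * cnj q"
    using assms(2) by auto
  ultimately have eq: "cpow \<alpha> \<beta> (1 + \<epsilon> * q) = (1 + \<epsilon> * q) powr of_real \<alpha> * (1 + \<epsilon> * cnj q) powr of_real \<beta>"
    by (simp only: cpow_eq_powr[OF assms(1)])
  show ?thesis
    using has_sum_times[OF has_sum_gbinomial[OF n(1), of "of_real \<alpha>"] has_sum_gbinomial[OF n(2), of "of_real \<beta>"]]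
    unfolding eq by (simp add: of_real_gbinomial case_prod_unfold power_mult_distrib power_add mult_ac)
qed

lemma finite_binom_mult_support:
  assumes "a \<in> R_laurent"
  shows "finite {(m :: nat, n :: nat). a (r - real m) (s - real n) \<noteq> 0}"
proof -
  obtain N where N: "\<And>r s. a r s \<noteq> 0 \<Longrightarrow> N \<le> r \<and> N \<le> s"
    using assms unfolding R_laurent_def by blast
  have "{(m :: nat, n :: nat). a (r - real m) (s - real n) \<noteq> 0}
      \<subseteq> {..nat \<lceil>r - N\<rceil>} \<times> {..nat \<lceil>s - N\<rceil>}"
  proof clarify
    fix m n assume "a (r - real m) (s - real n) \<noteq> 0"
    then have "real m \<le> r - N" "real n \<le> s - N"
      using N by fastforce+
    then show "m \<in> {..nat \<lceil>r - N\<rceil>} \<and> n \<in> {..nat \<lceil>s - N\<rceil>}"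
      by (metis atMost_iff ceiling_mono ceiling_of_nat nat_int nat_mono)
  qed
  then show ?thesis
    by (rule finite_subset) auto
qed

lemma expands_binom_mult:
  assumes a: "a \<in> R_laurent" "expands a g" and \<alpha>\<beta>: "\<alpha> - \<beta> \<in> \<int>" and \<epsilon>: "\<epsilon> = 1 \<or> \<epsilon> = - 1"
  shows "expands (binom_mult \<alpha> \<beta> \<epsilon> a) (\<lambda>q. cpow \<alpha> \<beta> (1 + \<epsilon> * q) * g q)"
proof -
  obtain R where R: "R > 0" "\<And>q. 0 < cmod q \<Longrightarrow> cmod q < R \<Longrightarrow>
      ((\<lambda>(r, s). a r s * cpow r s q) has_sum g q) UNIV"
    using a(2) unfolding expands_def by blast
  define C where "C = (\<lambda>(m, n). complex_of_real (\<alpha> gchoose m) * complex_of_real (\<beta> gchoose n) * \<epsilon> ^ (m + n))"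
  have "((\<lambda>(r, s). binom_mult \<alpha> \<beta> \<epsilon> a r s * cpow r s q) has_sum cpow \<alpha> \<beta> (1 + \<epsilon> * q) * g q) UNIV"
    if q: "0 < cmod q" "cmod q < min R 1" for q
  proof -
    have q0: "q \<noteq> 0" and q1: "cmod q < 1" and qR: "cmod q < R"
      using q by auto
    \<comment> \<open>The product series is indexed by its total exponents; for fixed total exponents, the sum over
      the binomial indices is finite.\<close>
    have shift: "cpow (r + real m) (s + real n) q = q ^ m * cnj q ^ n * cpow r s q" for m n r s
      using cpow_add[of "real m" "real n" q r s] q0 by (simp add: cpow_of_nat add.commute)
    have "((\<lambda>(p, p'). (C p * (q ^ fst p * cnj q ^ snd p)) * (a (fst p') (snd p') * cpow (fst p') (snd p') q))
        has_sum (cpow \<alpha> \<beta> (1 + \<epsilon> * q) * g q)) (UNIV \<times> UNIV)"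
      using has_sum_times[OF has_sum_binomial_cpow[OF \<alpha>\<beta> \<epsilon> q1] R(2)[OF q(1) qR]]
      by (simp add: C_def case_prod_unfold)
    also have "?this \<longleftrightarrow> ((\<lambda>(p', p). C p * a (fst p' - real (fst p)) (snd p' - real (snd p)) * cpow (fst p') (snd p') q)
        has_sum (cpow \<alpha> \<beta> (1 + \<epsilon> * q) * g q)) (UNIV \<times> UNIV)"
      by (rule has_sum_reindex_bij_witness[of _
          "\<lambda>((r, s), (m, n)). ((m, n), (r - real m, s - real n))"
          "\<lambda>((m, n), (r, s)). ((r + real m, s + real n), (m, n))"])
         (auto simp: shift)
    finally have 1: "((\<lambda>(p', p). C p * a (fst p' - real (fst p)) (snd p' - real (snd p)) * cpow (fst p') (snd p') q)
        has_sum (cpow \<alpha> \<beta> (1 + \<epsilon> * q) * g q)) (UNIV \<times> UNIV)" .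
    have 2: "((\<lambda>p. C p * a (fst p' - real (fst p)) (snd p' - real (snd p)) * cpow (fst p') (snd p') q)
        has_sum binom_mult \<alpha> \<beta> \<epsilon> a (fst p') (snd p') * cpow (fst p') (snd p') q) UNIV" for p'
    proof -
      have "((\<lambda>p. C p * a (fst p' - real (fst p)) (snd p' - real (snd p)))
        has_sum binom_mult \<alpha> \<beta> \<epsilon> a (fst p') (snd p')) UNIV"
        unfolding binom_mult_def C_def case_prod_unfold
        by (rule has_sum_Sum_any, rule finite_subset[OF _ finite_binom_mult_support[OF a(1), of "fst p'" "snd p'"]]) auto
      from has_sum_cmult_left[OF this] show ?thesis .
    qed
    have "((\<lambda>p'. binom_mult \<alpha> \<beta> \<epsilon> a (fst p') (snd p') * cpow (fst p') (snd p') q)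
        has_sum cpow \<alpha> \<beta> (1 + \<epsilon> * q) * g q) UNIV"
      by (rule has_sum_SigmaD[OF 1]) (use 2 in simp)
    then show ?thesis
      by (simp add: case_prod_unfold)
  qed
  then show ?thesis
    using R(1) unfolding expands_def by (intro exI[of _ "min R 1"]) auto
qed

section \<open>The three expansions of a correlation function\<close>

lemma twist_in_R_laurent:
  "a \<in> R_laurent \<Longrightarrow> (\<lambda>r s. (- 1) powi \<lfloor>r - s\<rfloor> * a r s) \<in> R_laurent"
  by (simp add: R_laurent_def)

lemma expands_twist:
  assumes "expands a g"
  shows "expands (\<lambda>r s. (- 1) powi \<lfloor>r - s\<rfloor> * a r s) (\<lambda>q. g (- q))"
proof -
  obtain R where R: "R > 0" "\<And>q. 0 < cmod q \<Longrightarrow> cmod q < R \<Longrightarrow>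
      ((\<lambda>(r, s). a r s * cpow r s q) has_sum g q) UNIV"
    using assms(1) unfolding expands_def by blast
  have "((\<lambda>(r, s). (- 1) powi \<lfloor>r - s\<rfloor> * a r s * cpow r s q) has_sum g (- q)) UNIV"
    if "0 < cmod q" "cmod q < R" for q
    using R(2)[of "- q"] that by (simp add: cpow_minus case_prod_unfold mult_ac)
  then show ?thesis
    using R(1) unfolding expands_def by blast
qed

text \<open>
  On the part of bidegree \<open>(A, B)\<close>, an element of \<open>GCor_2\<close> is \<open>z1^A zbar1^B g(z2/z1)\<close> for one real
  analytic function \<open>g\<close> on the plane without \<open>0\<close> and \<open>1\<close>.  Its three formal expansions converge
  to this function, written in the coordinates \<open>z2/z1\<close>, \<open>z0/z2\<close> and \<open>z1/z2\<close>.  This is all that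
  is used about \<open>GCor_2\<close>.
\<close>

lemma GCor2_expansions:
  assumes "GCor2 \<mu> S12 S20 S21" "A - B \<in> \<int>"
  shows "\<exists>g. complexifiable_on g (- {0, 1})
    \<and> expands (\<lambda>r s. S12 (A - r) (B - s) r s) g
    \<and> expands (\<lambda>r s. S20 (A - r) (B - s) r s) (\<lambda>w. cpow A B (1 + w) * g (1 / (1 + w)))
    \<and> expands (\<lambda>r s. S21 (A - r) (B - s) r s) (\<lambda>p. cpow A B p * g (1 / p))"
  using assms(1)
proof induction
  case (generator f \<alpha>1 \<beta>1 \<alpha>2 \<beta>2 \<alpha>12 \<beta>12 a0 ainf a1)
  show ?case
  proof (cases "A = \<alpha>1 + \<alpha>2 + \<alpha>12 \<and> B = \<beta>1 + \<beta>2 + \<beta>12")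
    case False
    then show ?thesis
      by (intro exI[of _ "\<lambda>_. 0"]) (auto simp: ratio_series_def complexifiable_on_const expands_0)
  next
    case True
    define g where "g = (\<lambda>p. cpow \<alpha>2 \<beta>2 p * (cpow \<alpha>12 \<beta>12 (1 - p) * f p))"
    have L: "a0 \<in> R_laurent" "ainf \<in> R_laurent" "a1 \<in> R_laurent"
      using generator by (auto simp: conf_converges_def)
    have AB: "cpow A B z = cpow \<alpha>1 \<beta>1 z * cpow \<alpha>2 \<beta>2 z * cpow \<alpha>12 \<beta>12 z" if "z \<noteq> 0" for z
    proof -
      have "\<alpha>1 + \<alpha>2 - (\<beta>1 + \<beta>2) \<in> \<int>"
        using Ints_add[OF generator(2,3)] by (simp add: algebra_simps)
      then show ?thesis
        using generator(2) that True by (simp add: cpow_add)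
    qed
    have inv: "cpow r s z * cpow r s (1 / z) = 1" if "z \<noteq> 0" for r s z
      using cpow_mult[of r s z "1 / z"] that by simp
    have "complexifiable_on f (- {0, 1})"
      using generator(1) by (simp add: F01inf_def real_analytic_on_imp_complexifiable_on)
    moreover have "complexifiable_on (\<lambda>p. cpow \<alpha>2 \<beta>2 p) (- {0, 1})"
      by (rule complexifiable_on_subset[OF complexifiable_on_cpow[of 1 \<alpha>2 \<beta>2 0, simplified]]) auto
    moreover have "complexifiable_on (\<lambda>p. cpow \<alpha>12 \<beta>12 (1 - p)) (- {0, 1})"
      by (rule complexifiable_on_subset[OF complexifiable_on_cpow[of "- 1" \<alpha>12 \<beta>12 1, simplified]]) auto
    ultimately have 1: "complexifiable_on g (- {0, 1})"
      unfolding g_def by (intro complexifiable_on_mult)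
    have 2: "expands (\<lambda>r s. binom_mult \<alpha>12 \<beta>12 (- 1) a0 (r - \<alpha>2) (s - \<beta>2)) g"
      using expands_shift[OF expands_binom_mult[OF L(1) conf_converges_imp_expands], of f \<alpha>12 \<beta>12 "- 1" \<alpha>2 \<beta>2]
        generator by (simp add: g_def)
    have "expands (\<lambda>r' s'. (- 1) powi \<lfloor>r' - s'\<rfloor> * a1 r' s') (\<lambda>q. f (1 / (1 + q)))"
      using expands_twist[OF conf_converges_imp_expands[OF generator(7)]] by simp
    from expands_shift[OF expands_binom_mult[OF twist_in_R_laurent[OF L(3)] this], of \<alpha>1 \<beta>1 1 \<alpha>12 \<beta>12]
    have "expands (\<lambda>r s. binom_mult \<alpha>1 \<beta>1 1 (\<lambda>r' s'. (- 1) powi \<lfloor>r' - s'\<rfloor> * a1 r' s') (r - \<alpha>12) (s - \<beta>12))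
        (\<lambda>q. cpow \<alpha>12 \<beta>12 q * (cpow \<alpha>1 \<beta>1 (1 + q) * f (1 / (1 + q))))"
      using generator by simp
    then have 3: "expands (\<lambda>r s. binom_mult \<alpha>1 \<beta>1 1 (\<lambda>r' s'. (- 1) powi \<lfloor>r' - s'\<rfloor> * a1 r' s') (r - \<alpha>12) (s - \<beta>12))
        (\<lambda>w. cpow A B (1 + w) * g (1 / (1 + w)))"
    proof (rule expands_cong[where R = 1])
      fix q :: complex assume q: "0 < cmod q" "cmod q < 1"
      then have q1: "1 + q \<noteq> 0"
        by (metis add_eq_0_iff norm_minus_cancel norm_one less_irrefl)
      \<comment> \<open>with \<open>z2/z1 = 1 / (1 + q)\<close>, the factor \<open>z1 - z2\<close> contributes \<open>1 - z2/z1\<close>\<close>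
      have "1 - 1 / (1 + q) = q * (1 / (1 + q))"
        using q1 by (simp add: field_simps)
      then show "cpow \<alpha>12 \<beta>12 q * (cpow \<alpha>1 \<beta>1 (1 + q) * f (1 / (1 + q))) =
          cpow A B (1 + q) * g (1 / (1 + q))"
        using inv[OF q1, of \<alpha>2 \<beta>2] inv[OF q1, of \<alpha>12 \<beta>12] unfolding g_def AB[OF q1]
        by (simp only: cpow_mult) algebra
    qed simp
    from expands_cmult[OF expands_shift[OF expands_binom_mult[OF L(2) conf_converges_imp_expands[OF generator(6)]], of \<alpha>12 \<beta>12 "- 1" \<alpha>1 \<beta>1]]
    have "expands (\<lambda>r s. (- 1) powi \<lfloor>\<alpha>12 - \<beta>12\<rfloor> * binom_mult \<alpha>12 \<beta>12 (- 1) ainf (r - \<alpha>1) (s - \<beta>1))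
        (\<lambda>q. (- 1) powi \<lfloor>\<alpha>12 - \<beta>12\<rfloor> * (cpow \<alpha>1 \<beta>1 q * (cpow \<alpha>12 \<beta>12 (1 - q) * f (1 / q))))"
      using generator by simp
    then have 4: "expands (\<lambda>r s. (- 1) powi \<lfloor>\<alpha>12 - \<beta>12\<rfloor> * binom_mult \<alpha>12 \<beta>12 (- 1) ainf (r - \<alpha>1) (s - \<beta>1))
        (\<lambda>p. cpow A B p * g (1 / p))"
    proof (rule expands_cong[where R = 1])
      fix q :: complex assume q: "0 < cmod q" "cmod q < 1"
      then have q1: "q \<noteq> 0"
        by auto
      \<comment> \<open>the sign in the third expansion comes from \<open>z1 - z2 = - (z2 - z1)\<close>\<close>
      have "1 - 1 / q = (- 1) * (1 - q) * (1 / q)"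
        using q1 by (simp add: field_simps)
      then show "(- 1) powi \<lfloor>\<alpha>12 - \<beta>12\<rfloor> * (cpow \<alpha>1 \<beta>1 q * (cpow \<alpha>12 \<beta>12 (1 - q) * f (1 / q))) =
          cpow A B q * g (1 / q)"
        using inv[OF q1, of \<alpha>2 \<beta>2] inv[OF q1, of \<alpha>12 \<beta>12] unfolding g_def AB[OF q1]
        by (simp only: cpow_mult cpow_minus_one) algebra
    qed simp
    show ?thesis
      using 1 2 3 4 True by (intro exI[of _ g]) (simp add: ratio_series_def)
  qed
next
  case (add \<mu> S12 S20 S21 \<mu>' T12 T20 T21)
  then obtain g h where
    "complexifiable_on g (- {0, 1})" "complexifiable_on h (- {0, 1})"
    "expands (\<lambda>r s. S12 (A - r) (B - s) r s) g" "expands (\<lambda>r s. T12 (A - r) (B - s) r s) h"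
    "expands (\<lambda>r s. S20 (A - r) (B - s) r s) (\<lambda>w. cpow A B (1 + w) * g (1 / (1 + w)))"
    "expands (\<lambda>r s. T20 (A - r) (B - s) r s) (\<lambda>w. cpow A B (1 + w) * h (1 / (1 + w)))"
    "expands (\<lambda>r s. S21 (A - r) (B - s) r s) (\<lambda>p. cpow A B p * g (1 / p))"
    "expands (\<lambda>r s. T21 (A - r) (B - s) r s) (\<lambda>p. cpow A B p * h (1 / p))"
    by auto
  from complexifiable_on_add[OF this(1,2)] expands_add[OF this(3,4)] expands_add[OF this(5,6)] expands_add[OF this(7,8)]
  show ?case
    by (intro exI[of _ "\<lambda>p. g p + h p"]) (simp add: distrib_left)
next
  case (smult \<mu> S12 S20 S21 k)
  then obtain g where
    "complexifiable_on g (- {0, 1})"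
    "expands (\<lambda>r s. S12 (A - r) (B - s) r s) g"
    "expands (\<lambda>r s. S20 (A - r) (B - s) r s) (\<lambda>w. cpow A B (1 + w) * g (1 / (1 + w)))"
    "expands (\<lambda>r s. S21 (A - r) (B - s) r s) (\<lambda>p. cpow A B p * g (1 / p))"
    by auto
  from complexifiable_on_mult[OF complexifiable_on_const this(1), of k] this(2-)[THEN expands_cmult, of k]
  show ?case
    by (intro exI[of _ "\<lambda>p. k * g p"]) (simp add: mult.left_commute)
qed

section \<open>Laurent coefficients as contour integrals\<close>

lemma has_contour_integral_powi_circlepath:
  assumes "\<rho> > 0"
  shows "((\<lambda>t. t powi k) has_contour_integral (if k = - 1 then 2 * pi * \<i> else 0)) (circlepath 0 \<rho>)"
proof (cases "k = - 1")
  case True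
  have "((\<lambda>t. 1 / (t - 0)) has_contour_integral 2 * pi * \<i> * 1) (circlepath 0 \<rho>)"
    using Cauchy_integral_circlepath_simple[of "\<lambda>_. 1" 0 \<rho> 0] assms by simp
  then show ?thesis
    using True by (simp add: power_int_minus_left divide_inverse power_int_minus)
next
  case False
  then have k: "of_int (k + 1) \<noteq> (0 :: complex)"
    by (metis add.commute add_eq_0_iff of_int_eq_0_iff)
  have "((\<lambda>t. t powi k) has_contour_integral
      (pathfinish (circlepath 0 \<rho>) powi (k + 1) / of_int (k + 1)
        - pathstart (circlepath 0 \<rho>) powi (k + 1) / of_int (k + 1))) (circlepath 0 \<rho>)"
  proof (rule contour_integral_primitive[where S = "- {0}" and f = "\<lambda>t. t powi (k + 1) / of_int (k + 1)"])
    fix x :: complex assume "x \<in> - {0}"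
    then show "((\<lambda>t. t powi (k + 1) / of_int (k + 1)) has_field_derivative x powi k) (at x within - {0})"
      using k by (auto intro!: derivative_eq_intros)
  qed (use assms in auto)
  then show ?thesis
    using False by simp
qed

lemma has_sum_contour_integral_powi:
  fixes e :: "'i \<Rightarrow> int"
  assumes \<rho>: "\<rho> > 0"
    and sum: "\<And>t. cmod t = \<rho> \<Longrightarrow> ((\<lambda>i. c i * t powi e i) has_sum Q t) I"
  shows "((\<lambda>i. if e i = - 1 then 2 * pi * \<i> * c i else 0) has_sum contour_integral (circlepath 0 \<rho>) Q) I"
proof -
  have M: "(\<lambda>i. cmod (c i * of_real \<rho> powi e i)) summable_on I"
    using sum[of "of_real \<rho>"] \<rho>
    by (auto dest!: has_sum_imp_summable simp: summable_on_iff_abs_summable_on_complex)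
  have ul: "uniform_limit (sphere 0 \<rho>) (\<lambda>X t. \<Sum>i\<in>X. c i * t powi e i) Q (finite_subsets_at_top I)"
    by (rule Weierstrass_m_test_general'[OF _ _ M])
       (use sum \<rho> in \<open>auto simp: norm_mult norm_power_int\<close>)
  have int: "((\<lambda>t. \<Sum>i\<in>X. c i * t powi e i) has_contour_integral
      (\<Sum>i\<in>X. c i * (if e i = - 1 then 2 * pi * \<i> else 0))) (circlepath 0 \<rho>)" if "finite X" for X
    using that by (intro has_contour_integral_sum has_contour_integral_lmul
        has_contour_integral_powi_circlepath[OF \<rho>])
  have "((\<lambda>X. contour_integral (circlepath 0 \<rho>) (\<lambda>t. \<Sum>i\<in>X. c i * t powi e i)) \<longlongrightarrow>
      contour_integral (circlepath 0 \<rho>) Q) (finite_subsets_at_top I)"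
  proof (rule contour_integral_uniform_limit_circlepath[OF _ ul])
    show "\<forall>\<^sub>F X in finite_subsets_at_top I. (\<lambda>t. \<Sum>i\<in>X. c i * t powi e i) contour_integrable_on circlepath 0 \<rho>"
      using int by (auto intro!: eventually_finite_subsets_at_top_weakI has_contour_integral_integrable)
  qed (use \<rho> in auto)
  also have "?this \<longleftrightarrow> ((\<lambda>X. \<Sum>i\<in>X. if e i = - 1 then 2 * pi * \<i> * c i else 0) \<longlongrightarrow>
      contour_integral (circlepath 0 \<rho>) Q) (finite_subsets_at_top I)"
    by (intro tendsto_cong eventually_finite_subsets_at_top_weakI)
       (auto simp: contour_integral_unique[OF int] intro!: sum.cong)
  finally show ?thesis
    by (simp add: has_sum_def)
qed

text \<open>
  The exponents \<open>m\<close> run over all integers, so the lemma applies to small circles as well as to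
  large ones, where the series go in the direction of infinity.
\<close>

lemma has_sum_contour_integral_times:
  fixes d :: "int \<Rightarrow> complex" and k :: "nat \<Rightarrow> int"
  assumes \<rho>: "\<rho> > 0"
    and P: "\<And>t. cmod t = \<rho> \<Longrightarrow> ((\<lambda>i. b i * t powi k i) has_sum P t) UNIV"
    and H: "\<And>t. cmod t = \<rho> \<Longrightarrow> ((\<lambda>m. d m * t powi m) has_sum H t) UNIV"
  shows "((\<lambda>i. 2 * pi * \<i> * (b i * d (- 1 - k i))) has_sum
    contour_integral (circlepath 0 \<rho>) (\<lambda>t. P t * H t)) UNIV"
proof -
  \<comment> \<open>for each \<open>i\<close> only \<open>m = - 1 - k i\<close> contributes\<close>
  have "((\<lambda>p. if k (fst p) + snd p = - 1 then 2 * pi * \<i> * (b (fst p) * d (snd p)) else 0) has_sum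
      contour_integral (circlepath 0 \<rho>) (\<lambda>t. P t * H t)) (UNIV \<times> UNIV)"
  proof (rule has_sum_contour_integral_powi[OF \<rho>])
    fix t :: complex assume t: "cmod t = \<rho>"
    then have "t \<noteq> 0"
      using \<rho> by auto
    then show "((\<lambda>p. b (fst p) * d (snd p) * t powi (k (fst p) + snd p)) has_sum P t * H t) (UNIV \<times> UNIV)"
      using has_sum_times[OF P[OF t] H[OF t]] by (simp add: case_prod_unfold power_int_add mult_ac)
  qed
  then show ?thesis
  proof (rule has_sum_SigmaD)
    fix i
    show "((\<lambda>m. if k (fst (i, m)) + snd (i, m) = - 1 then 2 * pi * \<i> * (b (fst (i, m)) * d (snd (i, m))) else 0)
        has_sum 2 * pi * \<i> * (b i * d (- 1 - k i))) UNIV"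
      by (rule has_sum_finite_neutralI[of "{- 1 - k i}"]) auto
  qed
qed

lemma has_sum_laurent_zero:
  fixes d :: "int \<Rightarrow> complex"
  assumes "\<rho> > 0" "\<And>t. cmod t = \<rho> \<Longrightarrow> ((\<lambda>m. d m * t powi m) has_sum 0) UNIV"
  shows "d n = 0"
proof -
  have "((\<lambda>m. if m - n - 1 = - 1 then 2 * pi * \<i> * d m else 0) has_sum contour_integral (circlepath 0 \<rho>) (\<lambda>_. 0)) UNIV"
  proof (rule has_sum_contour_integral_powi[OF assms(1)])
    fix t :: complex assume t: "cmod t = \<rho>"
    then have t0: "t \<noteq> 0"
      using assms(1) by auto
    have "t powi (m - n - 1) = t powi m * t powi (- n - 1)" for m :: int
    proof -
      have "m - n - 1 = m + (- n - 1)" by simp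
      then show ?thesis
        by (simp only: power_int_add[OF disjI1[OF t0]])
    qed
    then show "((\<lambda>m. d m * t powi (m - n - 1)) has_sum 0) UNIV"
      using has_sum_cmult_left[OF assms(2)[OF t], of "t powi (- n - 1)"] by (simp add: mult_ac)
  qed
  moreover have "((\<lambda>m. if m - n - 1 = - 1 then 2 * pi * \<i> * d m else 0) has_sum (2 * pi * \<i> * d n)) UNIV"
    by (rule has_sum_finite_neutralI[of "{n}"]) auto
  ultimately show ?thesis
    using has_sum_unique by fastforce
qed

text \<open>
  No bound from below on the exponents is assumed: on a small disc around \<open>z\<close>, each term is
  dominated by the sum of its absolute values at the radii \<open>|z| + e\<close> and \<open>|z| - e\<close>.
\<close>

lemma laurent_has_sum_holomorphic:
  fixes d :: "int \<Rightarrow> complex"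
  assumes sum: "\<And>t. 0 < cmod t \<Longrightarrow> cmod t < R \<Longrightarrow> ((\<lambda>m. d m * t powi m) has_sum g t) UNIV"
  shows "g holomorphic_on ball 0 R - {0}"
proof -
  have "\<exists>e>0. g holomorphic_on ball z e" if z: "z \<in> ball 0 R - {0}" for z
  proof -
    have "open (ball 0 R - {0 :: complex})"
      by auto
    then obtain e where e: "e > 0" "cball z e \<subseteq> ball 0 R - {0}"
      using z by (meson open_contains_cball)
    define \<rho> where "\<rho> = (\<lambda>\<sigma> :: real. of_real (cmod z + \<sigma> * e) :: complex)"
    have ez: "e < cmod z"
    proof (rule ccontr)
      assume "\<not> e < cmod z"
      then have "0 \<in> cball z e" by simp
      then show False using e by blast
    qed
    have zR: "cmod z + e < R"
    proof -
      have "cball z e \<subseteq> ball 0 R"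
        using e(2) by blast
      then show ?thesis
        using e(1) by (simp add: cball_subset_ball_iff)
    qed
    have \<rho>n: "cmod (\<rho> \<sigma>) = cmod z + \<sigma> * e" if "\<sigma> = 1 \<or> \<sigma> = - 1" for \<sigma>
      using that ez e(1) by (auto simp: \<rho>_def simp del: of_real_add of_real_diff)
    have S: "(\<lambda>m. cmod (d m * \<rho> \<sigma> powi m)) summable_on UNIV" if "\<sigma> = 1 \<or> \<sigma> = - 1" for \<sigma>
      using sum[of "\<rho> \<sigma>"] \<rho>n[OF that] ez zR e(1) that
      by (auto dest!: has_sum_imp_summable simp: summable_on_iff_abs_summable_on_complex)
    have M: "(\<lambda>m. cmod (d m * \<rho> 1 powi m) + cmod (d m * \<rho> (- 1) powi m)) summable_on UNIV"
      by (intro summable_on_add S) auto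
    have le: "cmod (d m * t powi m) \<le> cmod (d m * \<rho> 1 powi m) + cmod (d m * \<rho> (- 1) powi m)"
      if "t \<in> cball z e" for m t
    proof -
      have t: "cmod t \<le> cmod z + e" "cmod z - e \<le> cmod t"
        using that norm_triangle_sub[of t z] norm_triangle_sub[of z t]
        by (auto simp: dist_norm norm_minus_commute)
      have "cmod t powi m \<le> (cmod z + e) powi m + (cmod z - e) powi m"
      proof (cases "m \<ge> 0")
        case True
        then have "cmod t powi m \<le> (cmod z + e) powi m"
          using t by (intro power_int_mono) auto
        moreover have "(cmod z - e) powi m \<ge> 0"
          using ez by simp
        ultimately show ?thesis by linarith
      next
        case False
        then have "cmod t powi m \<le> (cmod z - e) powi m"
          using t ez by (intro power_int_antimono) auto
        moreover have "(cmod z + e) powi m \<ge> 0"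
          using e by simp
        ultimately show ?thesis by linarith
      qed
      then have "cmod (d m) * cmod t powi m \<le> cmod (d m) * ((cmod z + e) powi m + (cmod z - e) powi m)"
        by (intro mult_left_mono) auto
      then show ?thesis
        by (simp add: norm_mult norm_power_int \<rho>n distrib_left)
    qed
    have nz: "0 < cmod t" "cmod t < R" if "t \<in> cball z e" for t
      using subsetD[OF e(2) that] by auto
    have ul: "uniform_limit (cball z e) (\<lambda>X t. \<Sum>m\<in>X. d m * t powi m) g (finite_subsets_at_top UNIV)"
      by (rule Weierstrass_m_test_general'[OF le _ M]) (use sum nz in auto)
    show ?thesis
    proof (rule holomorphic_uniform_limit[OF _ ul])
      have "(\<lambda>t. \<Sum>m\<in>X. d m * t powi m) holomorphic_on cball z e" for X
        using nz by (intro holomorphic_intros) auto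
      then show "\<forall>\<^sub>F X in finite_subsets_at_top UNIV.
          continuous_on (cball z e) (\<lambda>t. \<Sum>m\<in>X. d m * t powi m) \<and>
          (\<lambda>t. \<Sum>m\<in>X. d m * t powi m) holomorphic_on ball z e"
        by (intro always_eventually allI conjI holomorphic_on_imp_continuous_on)
           (auto intro: holomorphic_on_subset[OF _ ball_subset_cball])
    qed (use e(1) in auto)
  qed
  then show ?thesis
    unfolding holomorphic_on_def
    by (metis centre_in_ball field_differentiable_at_within holomorphic_on_def holomorphic_on_imp_differentiable_at open_ball)
qed

section \<open>The residue theorem for the three expansions\<close>

lemma has_sum_one_plus_powi:
  fixes z :: complex
  assumes "cmod z < 1"
  shows "((\<lambda>i. (of_int n gchoose i) * z ^ i) has_sum (1 + z) powi n) UNIV"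
proof -
  have "1 + z \<noteq> 0"
    using assms by (metis add_eq_0_iff norm_minus_cancel norm_one less_irrefl)
  then have "(1 + z) powr of_int n = (1 + z) powi n"
    by (simp add: powr_def exp_power_int[symmetric] mult.commute)
  then show ?thesis
    using has_sum_gbinomial[OF assms, of "of_int n"] by simp
qed

text \<open>
  With \<open>H(t) = t^A g(1/t)\<close>, the coefficients \<open>c12\<close>, \<open>c20\<close>, \<open>c21\<close> describe \<open>H\<close> near infinity, \<open>1\<close>
  and \<open>0\<close>.  The integral of \<open>t^p (t - 1)^r H(t)\<close> over a large circle is the sum of its integrals
  over small circles around \<open>0\<close> and \<open>1\<close>.  Expanding the factor \<open>t^p (t - 1)^r\<close> binomially at each of
  the three points gives the three sums of the Borcherds identity.
\<close>

lemma residue_identity: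
  fixes c12 c20 c21 :: "int \<Rightarrow> complex" and A p r :: int
  assumes hol: "g holomorphic_on - {0, 1}" and R: "R > 0"
    and h12: "\<And>t. 0 < cmod t \<Longrightarrow> cmod t < R \<Longrightarrow> ((\<lambda>m. c12 m * t powi m) has_sum g t) UNIV"
    and h20: "\<And>t. 0 < cmod t \<Longrightarrow> cmod t < R \<Longrightarrow>
      ((\<lambda>m. c20 m * t powi m) has_sum (1 + t) powi A * g (1 / (1 + t))) UNIV"
    and h21: "\<And>t. 0 < cmod t \<Longrightarrow> cmod t < R \<Longrightarrow>
      ((\<lambda>m. c21 m * t powi m) has_sum t powi A * g (1 / t)) UNIV"
  obtains x12 x20 x21 where
    "((\<lambda>i. (- 1) ^ i * (of_int r gchoose i) * c12 (A + 1 + p + r - int i)) has_sum x12) UNIV"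
    "((\<lambda>i. (of_int p gchoose i) * c20 (- 1 - (r + int i))) has_sum x20) UNIV"
    "((\<lambda>i. (- 1) ^ i * (of_int r gchoose i) * ((- 1) powi r * c21 (- 1 - (p + int i)))) has_sum x21) UNIV"
    "x20 = x12 - x21"
proof -
  define H where "H = (\<lambda>t. t powi A * g (1 / t))"
  define P where "P = (\<lambda>t :: complex. t powi p * (t - 1) powi r)"
  define f where "f = (\<lambda>t. P t * H t)"
  define \<epsilon> where "\<epsilon> = min R 1 / 2"
  have \<epsilon>: "0 < \<epsilon>" "\<epsilon> < R" "\<epsilon> < 1"
    using R by (auto simp: \<epsilon>_def)
  \<comment> \<open>on the circle of radius \<open>1 / \<epsilon>\<close> the expansion of \<open>g\<close> at \<open>1/t\<close> converges\<close>
  define \<rho> where "\<rho> = 1 / \<epsilon>"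
  have \<rho>: "\<rho> > 1" "\<rho> > 0"
    using \<epsilon> by (auto simp: \<rho>_def)
  have "(\<lambda>t. g (1 / t)) holomorphic_on UNIV - {0, 1}"
    by (rule holomorphic_on_compose_gen[of "\<lambda>t. 1 / t", OF _ hol, unfolded o_def])
       (auto intro!: holomorphic_intros)
  then have holf: "f holomorphic_on UNIV - {0, 1}"
    unfolding f_def P_def H_def by (intro holomorphic_intros) auto
  have inf: "((\<lambda>i. 2 * pi * \<i> * ((- 1) ^ i * (of_int r gchoose i) * c12 (A - (- 1 - (p + r - int i)))))
      has_sum contour_integral (circlepath 0 \<rho>) f) UNIV"
    unfolding f_def
  proof (rule has_sum_contour_integral_times[OF \<rho>(2)])
    fix t :: complex assume t: "cmod t = \<rho>"
    then have t0: "t \<noteq> 0"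
      using \<rho> by auto
    have nt: "cmod (1 / t) = \<epsilon>"
      using t by (simp add: norm_divide \<rho>_def)
    have "t - 1 = t * (1 + - (1 / t))"
      using t0 by (simp add: field_simps)
    then have P: "P t = t powi (p + r) * (1 + - (1 / t)) powi r"
      using t0 by (simp only: P_def power_int_mult_distrib power_int_add[OF disjI1[OF t0]] mult.assoc)
    have pw: "t powi (p + r - int i) = t powi (p + r) * (1 / t) ^ i" for i
      using t0 by (simp add: power_int_diff power_one_over divide_inverse power_inverse)
    have "cmod (- (1 / t)) < 1"
      using nt \<epsilon> by simp
    from has_sum_cmult_right[OF has_sum_one_plus_powi[OF this, of r], of "t powi (p + r)"]
    show "((\<lambda>i. (- 1) ^ i * (of_int r gchoose i) * t powi (p + r - int i)) has_sum P t) UNIV"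
      unfolding P pw by (simp add: power_minus[of "1 / t"] mult_ac)
    have pw': "t powi (A - m) = t powi A * (1 / t) powi m" for m
      using t0 by (simp add: power_int_diff power_int_divide_distrib divide_inverse power_int_inverse)
    have "((\<lambda>m. c12 m * t powi (A - m)) has_sum H t) UNIV"
      using has_sum_cmult_right[OF h12[of "1 / t"], of "t powi A"] nt \<epsilon>
      unfolding H_def pw' by (simp add: mult_ac)
    also have "?this \<longleftrightarrow> ((\<lambda>m. c12 (A - m) * t powi m) has_sum H t) UNIV"
      by (rule has_sum_reindex_bij_witness[of _ "\<lambda>m. A - m" "\<lambda>m. A - m"]) auto
    finally show "((\<lambda>m. c12 (A - m) * t powi m) has_sum H t) UNIV" .
  qed
  have zero: "((\<lambda>i. 2 * pi * \<i> * ((- 1) ^ i * (of_int r gchoose i) * (- 1) powi r * c21 (- 1 - (p + int i))))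
      has_sum contour_integral (circlepath 0 \<epsilon>) f) UNIV"
    unfolding f_def
  proof (rule has_sum_contour_integral_times[OF \<epsilon>(1)])
    fix t :: complex assume t: "cmod t = \<epsilon>"
    then have t0: "t \<noteq> 0"
      using \<epsilon> by auto
    have "t - 1 = (- 1) * (1 + - t)"
      by simp
    then have P: "P t = t powi p * ((- 1) powi r * (1 + - t) powi r)"
      by (simp only: P_def power_int_mult_distrib)
    have pw: "t powi (p + int i) = t powi p * t ^ i" for i
      using t0 by (simp add: power_int_add)
    have "cmod (- t) < 1"
      using t \<epsilon> by simp
    from has_sum_cmult_right[OF has_sum_one_plus_powi[OF this, of r], of "t powi p * (- 1) powi r"]
    show "((\<lambda>i. (- 1) ^ i * (of_int r gchoose i) * (- 1) powi r * t powi (p + int i)) has_sum P t) UNIV"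
      unfolding P pw by (simp add: power_minus[of t] mult_ac)
    show "((\<lambda>m. c21 m * t powi m) has_sum H t) UNIV"
      unfolding H_def by (rule h21) (use t \<epsilon> in auto)
  qed
  have one: "((\<lambda>i. 2 * pi * \<i> * ((of_int p gchoose i) * c20 (- 1 - (r + int i))))
      has_sum contour_integral (circlepath 0 \<epsilon>) (\<lambda>w. f (1 + w))) UNIV"
    unfolding f_def
  proof (rule has_sum_contour_integral_times[OF \<epsilon>(1)])
    fix t :: complex assume t: "cmod t = \<epsilon>"
    then have t0: "t \<noteq> 0"
      using \<epsilon> by auto
    have pw: "t powi (r + int i) = t powi r * t ^ i" for i
      using t0 by (simp add: power_int_add)
    have "cmod t < 1"
      using t \<epsilon> by simp
    from has_sum_cmult_right[OF has_sum_one_plus_powi[OF this, of p], of "t powi r"]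
    show "((\<lambda>i. (of_int p gchoose i) * t powi (r + int i)) has_sum P (1 + t)) UNIV"
      unfolding P_def pw by (simp add: mult_ac)
    show "((\<lambda>m. c20 m * t powi m) has_sum H (1 + t)) UNIV"
      unfolding H_def by (rule h20) (use t \<epsilon> in auto)
  qed
  have res0: "contour_integral (circlepath 0 \<epsilon>) f = 2 * pi * \<i> * residue f 0"
  proof (rule contour_integral_unique, rule base_residue[of "ball 0 1"])
    show "f holomorphic_on ball 0 1 - {0}"
      by (rule holomorphic_on_subset[OF holf]) auto
  qed (use \<epsilon> in auto)
  have res1: "contour_integral (circlepath 0 \<epsilon>) (\<lambda>w. f (1 + w)) = 2 * pi * \<i> * residue f 1"
    unfolding residue_shift_0[of f 1]
  proof (rule contour_integral_unique, rule base_residue[of "ball 0 1"])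
    show "(\<lambda>w. f (1 + w)) holomorphic_on ball 0 1 - {0}"
      by (rule holomorphic_on_compose_gen[of "\<lambda>w. 1 + w", OF _ holf, unfolded o_def])
         (auto intro!: holomorphic_intros simp: add_eq_0_iff)
  qed (use \<epsilon> in auto)
  have "contour_integral (circlepath 0 \<rho>) f =
      2 * pi * \<i> * (\<Sum>q\<in>{0, 1}. winding_number (circlepath 0 \<rho>) q * residue f q)"
    by (rule Residue_theorem[OF open_UNIV connected_UNIV _ holf]) (use \<rho> in auto)
  also have "\<dots> = contour_integral (circlepath 0 \<epsilon>) f + contour_integral (circlepath 0 \<epsilon>) (\<lambda>w. f (1 + w))"
    using \<rho> unfolding res0 res1 by (simp add: winding_number_circlepath algebra_simps)
  finally have sum: "contour_integral (circlepath 0 \<rho>) f =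
    contour_integral (circlepath 0 \<epsilon>) f + contour_integral (circlepath 0 \<epsilon>) (\<lambda>w. f (1 + w))" .
  have div: "(h has_sum x / (2 * pi * \<i>)) UNIV" if "((\<lambda>i. 2 * pi * \<i> * h i) has_sum x) UNIV"
    for h :: "nat \<Rightarrow> complex" and x
    using that by (subst (asm) has_sum_cmult_right_iff) auto
  show ?thesis
  proof
    show "((\<lambda>i. (- 1) ^ i * (of_int r gchoose i) * c12 (A + 1 + p + r - int i)) has_sum
        contour_integral (circlepath 0 \<rho>) f / (2 * pi * \<i>)) UNIV"
      using div[OF inf] by (simp add: algebra_simps)
    show "((\<lambda>i. (of_int p gchoose i) * c20 (- 1 - (r + int i))) has_sum
        contour_integral (circlepath 0 \<epsilon>) (\<lambda>w. f (1 + w)) / (2 * pi * \<i>)) UNIV"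
      using div[OF one] by (simp add: algebra_simps)
    show "((\<lambda>i. (- 1) ^ i * (of_int r gchoose i) * ((- 1) powi r * c21 (- 1 - (p + int i)))) has_sum
        contour_integral (circlepath 0 \<epsilon>) f / (2 * pi * \<i>)) UNIV"
      using div[OF zero] by (simp add: algebra_simps)
    show "contour_integral (circlepath 0 \<epsilon>) (\<lambda>w. f (1 + w)) / (2 * pi * \<i>) =
        contour_integral (circlepath 0 \<rho>) f / (2 * pi * \<i>) - contour_integral (circlepath 0 \<epsilon>) f / (2 * pi * \<i>)"
      unfolding sum by (simp add: add_divide_distrib)
  qed
qed

section \<open>Reading off coefficients from an expansion\<close>

text \<open>
  A series with integral powers of \<open>z\<close> and no powers of \<open>zbar\<close> is an ordinary Laurent series.
\<close>

lemma expands_on_integers: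
  assumes "expands a g" and supp: "\<And>r s. a r s \<noteq> 0 \<Longrightarrow> r \<in> \<int> \<and> s = 0"
  obtains R where "R > 0" "\<And>t. 0 < cmod t \<Longrightarrow> cmod t < R \<Longrightarrow>
    ((\<lambda>m :: int. a (of_int m) 0 * t powi m) has_sum g t) UNIV"
proof -
  obtain R where R: "R > 0" "\<And>q. 0 < cmod q \<Longrightarrow> cmod q < R \<Longrightarrow>
      ((\<lambda>(r, s). a r s * cpow r s q) has_sum g q) UNIV"
    using assms(1) unfolding expands_def by blast
  have "((\<lambda>m :: int. a (of_int m) 0 * t powi m) has_sum g t) UNIV" if t: "0 < cmod t" "cmod t < R" for t
  proof -
    define F where "F = (\<lambda>(r, s). a r s * cpow r s t)"
    define h where "h = (\<lambda>m :: int. (real_of_int m, 0 :: real))"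
    have inj: "inj_on h UNIV"
      by (auto simp: h_def inj_on_def)
    have 0: "F x = 0" if "x \<notin> range h" for x
    proof (rule ccontr)
      obtain r s where x: "x = (r, s)"
        by (cases x) auto
      assume "F x \<noteq> 0"
      then have "r \<in> \<int>" "s = 0"
        using supp[of r s] by (auto simp: F_def x)
      then show False
        using that by (auto simp: x h_def elim!: Ints_cases)
    qed
    have "(F has_sum g t) UNIV \<longleftrightarrow> (F has_sum g t) (range h)"
      by (rule has_sum_cong_neutral) (use 0 in auto)
    then have "((F \<circ> h) has_sum g t) UNIV"
      using R(2)[OF t] has_sum_reindex[OF inj, of F "g t"] by (simp add: F_def)
    then show ?thesis
      using t by (simp add: F_def h_def o_def cpow_of_int)
  qed
  then show ?thesis
    using R(1) that by blast
qed

lemma connected_minus_0_1: "connected (- {0, 1 :: complex})"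
  using connected_open_delete_finite[of "UNIV :: complex set" "{0, 1}"]
  by (simp add: Compl_eq_Diff_UNIV connected_UNIV)

text \<open>
  A constant is holomorphic, so the two identity theorems combine.
\<close>

lemma complexifiable_on_const_germ:
  assumes g: "complexifiable_on g (- {0, 1})" and R: "R > 0"
    and eq: "\<And>q. 0 < cmod q \<Longrightarrow> cmod q < R \<Longrightarrow> g q = \<kappa>"
    and z: "z \<noteq> 0" "z \<noteq> 1"
  shows "g z = \<kappa>"
proof -
  define U where "U = ball 0 (min R 1) - {0 :: complex}"
  obtain t where "0 < t" "t < min R 1"
    using R dense[of 0 "min R 1"] by auto
  then have "of_real t \<in> U"
    by (simp add: U_def)
  then have ne: "U \<noteq> {}"
    by blast
  have U: "open U" "U \<subseteq> - {0, 1}"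
    by (auto simp: U_def)
  have gU: "g z = \<kappa>" if "z \<in> U" for z
    using that eq by (auto simp: U_def)
  have "g holomorphic_on U"
    by (rule holomorphic_transform[of "\<lambda>_. \<kappa>"]) (use gU in auto)
  then have hol: "g holomorphic_on - {0, 1}"
    by (intro complexifiable_on_holomorphic[OF g _ connected_minus_0_1 U(1) ne U(2)]) auto
  show ?thesis
    by (rule analytic_continuation_open[OF U(1) _ ne connected_minus_0_1 U(2) hol, of "\<lambda>_. \<kappa>"]) (use z gU in auto)
qed

lemma powser_zero_on_positive_reals:
  fixes d :: "nat \<Rightarrow> complex"
  assumes r: "r > 0" and sum: "\<And>x :: real. 0 < x \<Longrightarrow> x < r \<Longrightarrow> ((\<lambda>n. d n * of_real x ^ n) has_sum 0) UNIV"
  shows "d 0 = 0"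
proof -
  define f where "f = (\<lambda>z :: complex. suminf (\<lambda>n. d n * z ^ n))"
  have sm: "(\<lambda>n. d n * of_real (r / 2) ^ n) sums 0"
    using sum[of "r / 2"] r by (intro has_sum_imp_sums) auto
  have "(\<lambda>n. d n * z ^ n) sums f z" if "norm z < r / 2" for z
    unfolding f_def using that r
    by (intro summable_sums powser_inside[OF sums_summable[OF sm]]) auto
  then have lim: "(f \<longlongrightarrow> d 0) (at 0)"
    using r by (intro powser_limit_0[of "r / 2"]) auto
  define x where "x = (\<lambda>n. r / real (n + 2))"
  have x: "0 < x n" "x n < r" for n
    using r by (auto simp: x_def field_simps add_pos_nonneg)
  have "x \<longlonglongrightarrow> 0"
    unfolding x_def by real_asymp
  then have "(\<lambda>n. complex_of_real (x n)) \<longlonglongrightarrow> 0"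
    using tendsto_of_real[of x 0] by simp
  then have "filterlim (\<lambda>n. complex_of_real (x n)) (at 0) sequentially"
    using x by (intro filterlim_atI) (auto intro!: always_eventually simp: less_imp_neq[symmetric])
  from filterlim_compose[OF lim this] have "(\<lambda>n. f (of_real (x n))) \<longlonglongrightarrow> d 0" .
  moreover have "f (of_real (x n)) = 0" for n
    using has_sum_imp_sums[OF sum[OF x[of n]]] by (simp add: f_def sums_iff)
  ultimately show ?thesis
    by (simp add: LIMSEQ_const_iff)
qed

text \<open>
  The coefficient of \<open>wbar\<close> in an expansion of \<open>\<kappa> (1 + w)^A (1 + wbar)^B\<close>.  This is the uniqueness of
  power series in \<open>w\<close> and \<open>wbar\<close>, needed for one coefficient only: integration over circles
  isolates the terms \<open>w^j wbar^(j+1)\<close>, and a power series in the squared radius remains.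
\<close>

lemma expands_cpow_coeff_0_1:
  assumes a: "expands a (\<lambda>w. cpow A B (1 + w) * \<kappa>)" and AB: "A - B \<in> \<int>"
    and supp: "\<And>r s. a r s \<noteq> 0 \<Longrightarrow> r \<in> \<nat> \<and> s \<in> \<nat>"
  shows "a 0 1 = B * \<kappa>"
proof -
  obtain R where R: "R > 0" "\<And>q. 0 < cmod q \<Longrightarrow> cmod q < R \<Longrightarrow>
      ((\<lambda>(r, s). a r s * cpow r s q) has_sum (cpow A B (1 + q) * \<kappa>)) UNIV"
    using a unfolding expands_def by blast
  \<comment> \<open>the coefficients of the difference of the two series\<close>
  define d where "d = (\<lambda>m n :: nat. a (real m) (real n)
      - complex_of_real (A gchoose m) * complex_of_real (B gchoose n) * \<kappa>)"
  have sum0: "((\<lambda>(m, n). d m n * (q ^ m * cnj q ^ n)) has_sum 0) UNIV"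
    if q: "0 < cmod q" "cmod q < min R 1" for q
  proof -
    define F where "F = (\<lambda>(r, s). a r s * cpow r s q)"
    define h where "h = (\<lambda>(m, n). (real m, real n))"
    have inj: "inj_on h UNIV"
      by (auto simp: h_def inj_on_def)
    have 0: "F x = 0" if "x \<notin> range h" for x
    proof (rule ccontr)
      obtain r s where x: "x = (r, s)"
        by (cases x) auto
      assume "F x \<noteq> 0"
      then have "r \<in> \<nat>" "s \<in> \<nat>"
        using supp[of r s] by (auto simp: F_def x)
      then show False
        using that by (auto simp: x h_def elim!: Nats_cases)
    qed
    have "(F has_sum (cpow A B (1 + q) * \<kappa>)) UNIV \<longleftrightarrow> (F has_sum (cpow A B (1 + q) * \<kappa>)) (range h)"
      by (rule has_sum_cong_neutral) (use 0 in auto)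
    then have "((F \<circ> h) has_sum (cpow A B (1 + q) * \<kappa>)) UNIV"
      using R(2)[of q] q has_sum_reindex[OF inj, of F] by (simp add: F_def)
    then have 1: "((\<lambda>(m, n). a (real m) (real n) * (q ^ m * cnj q ^ n)) has_sum (cpow A B (1 + q) * \<kappa>)) UNIV"
      using q by (simp add: F_def h_def o_def cpow_of_nat case_prod_unfold)
    have "cmod q < 1"
      using q by simp
    from has_sum_cmult_left[OF has_sum_binomial_cpow[OF AB _ this, of 1], of \<kappa>]
    have "((\<lambda>(m, n). complex_of_real (A gchoose m) * complex_of_real (B gchoose n) * (q ^ m * cnj q ^ n) * \<kappa>)
        has_sum (cpow A B (1 + q) * \<kappa>)) UNIV"
      by (simp add: case_prod_unfold)
    from has_sum_add[OF 1 has_sum_cmult_right[OF this, of "- 1"]] show ?thesis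
      by (simp add: d_def case_prod_unfold algebra_simps)
  qed
  define r where "r = (min R 1)\<^sup>2"
  have r: "r > 0"
    using R by (simp add: r_def)
  have "((\<lambda>j. d j (Suc j) * of_real x ^ j) has_sum 0) UNIV" if x: "0 < x" "x < r" for x :: real
  proof -
    define \<rho> where "\<rho> = sqrt x"
    have \<rho>: "0 < \<rho>" "\<rho> < min R 1" "\<rho>\<^sup>2 = x"
      using x R(1) by (auto simp: \<rho>_def r_def intro!: real_less_lsqrt simp del: min_less_iff_conj)
    have "((\<lambda>p. if int (fst p) - int (snd p) = - 1 then 2 * pi * \<i> * (d (fst p) (snd p) * of_real x ^ snd p) else 0)
        has_sum contour_integral (circlepath 0 \<rho>) (\<lambda>_. 0)) UNIV"
    proof (rule has_sum_contour_integral_powi[OF \<rho>(1)])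
      fix t assume t: "cmod t = \<rho>"
      then have t0: "t \<noteq> 0"
        using \<rho> by auto
      \<comment> \<open>on this circle \<open>tbar = x / t\<close>, so the terms become powers of \<open>t\<close>\<close>
      have "t * cnj t = of_real x"
        using t \<rho>(3) complex_norm_square[of t] by simp
      then have "cnj t = of_real x / t"
        using t0 by (simp add: field_simps)
      then have "t ^ m * cnj t ^ n = of_real x ^ n * t powi (int m - int n)" for m n
        using t0 by (simp add: power_divide power_int_diff)
      then show "((\<lambda>p. d (fst p) (snd p) * of_real x ^ snd p * t powi (int (fst p) - int (snd p))) has_sum 0) UNIV"
        using sum0[of t] t \<rho> by (simp add: case_prod_unfold mult_ac)
    qed
    then have *: "((\<lambda>p. if int (fst p) - int (snd p) = - 1 then 2 * pi * \<i> * (d (fst p) (snd p) * of_real x ^ snd p) else 0)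
        has_sum 0) UNIV" (is "(?G has_sum 0) UNIV")
      by simp
    define h where "h = (\<lambda>j :: nat. (j, Suc j))"
    have inj: "inj_on h UNIV"
      by (auto simp: h_def inj_on_def)
    have "?G p = 0" if "p \<notin> range h" for p
    proof -
      have "int (fst p) - int (snd p) \<noteq> - 1"
      proof
        assume "int (fst p) - int (snd p) = - 1"
        then have "p = h (fst p)"
          by (simp add: h_def prod_eq_iff)
        then show False
          using that by blast
      qed
      then show ?thesis by simp
    qed
    then have "(?G has_sum 0) UNIV \<longleftrightarrow> (?G has_sum 0) (range h)"
      by (intro has_sum_cong_neutral) auto
    then have "((?G \<circ> h) has_sum 0) UNIV"
      using * has_sum_reindex[OF inj, of ?G 0] by simp
    then have "((\<lambda>j. (2 * pi * \<i> * of_real x) * (d j (Suc j) * of_real x ^ j)) has_sum 0) UNIV"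
      by (simp add: h_def o_def mult_ac)
    then show ?thesis
      by (subst (asm) has_sum_cmult_right_iff) (use x in auto)
  qed
  then have "d 0 (Suc 0) = 0"
    using powser_zero_on_positive_reals[OF r, of "\<lambda>j. d j (Suc j)"] by simp
  then show ?thesis
    by (simp add: d_def)
qed

section \<open>The kernel of the antiholomorphic derivation\<close>

context full_vertex_algebra
begin

text \<open>
  Functionals in the restricted dual are obtained by composing the projection onto one graded
  piece with a linear functional.
\<close>

lemma restricted_dual_separates:
  assumes "x \<noteq> 0"
  obtains u where "u \<in> restricted_dual scale gr" "u x \<noteq> 0"
proof -
  define dec where "dec = (\<lambda>x c. finite {i. c i \<noteq> 0} \<and> (\<forall>h hb. c (h, hb) \<in> gr h hb)
    \<and> x = (\<Sum>i | c i \<noteq> 0. c i))"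
  define C where "C = (\<lambda>x. THE c. dec x c)"
  have ex1: "\<exists>!c. dec y c" for y
    using gr_direct_sum[of y] unfolding dec_def .
  have dec_C: "dec y (C y)" for y
    unfolding C_def by (rule theI'[OF ex1])
  have C_eq: "C y = c" if "dec y c" for y c
    using ex1 dec_C that by blast
  have dec_add: "dec (y + y') (\<lambda>i. c i + c' i)" if "dec y c" "dec y' c'" for y y' c c'
  proof -
    let ?I = "{i. c i \<noteq> 0} \<union> {i. c' i \<noteq> 0}"
    have fin: "finite ?I"
      using that by (auto simp: dec_def)
    have "y = sum c ?I" "y' = sum c' ?I"
      using that fin by (auto simp: dec_def intro!: sum.mono_neutral_left)
    moreover have "(\<Sum>i | c i + c' i \<noteq> 0. c i + c' i) = (\<Sum>i\<in>?I. c i + c' i)"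
      using fin by (intro sum.mono_neutral_left) auto
    moreover have "finite {i. c i + c' i \<noteq> 0}"
      by (rule finite_subset[OF _ fin]) auto
    ultimately show ?thesis
      using that by (auto simp: dec_def sum.distrib intro!: subspace_add[OF gr_subspace])
  qed
  have dec_scale: "dec (scale k y) (\<lambda>i. scale k (c i))" if "dec y c" for k y c
  proof -
    have "finite {i. scale k (c i) \<noteq> 0}"
      by (rule finite_subset[of _ "{i. c i \<noteq> 0}"]) (use that in \<open>auto simp: dec_def\<close>)
    moreover have "(\<Sum>i | scale k (c i) \<noteq> 0. scale k (c i)) = (\<Sum>i | c i \<noteq> 0. scale k (c i))"
      using that by (intro sum.mono_neutral_left) (auto simp: dec_def)
    ultimately show ?thesis
      using that by (auto simp: dec_def scale_sum_right intro!: subspace_scale[OF gr_subspace])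
  qed
  have "\<exists>i. C x i \<noteq> 0"
  proof (rule ccontr)
    assume "\<nexists>i. C x i \<noteq> 0"
    then have "{i. C x i \<noteq> 0} = {}"
      by blast
    then have "(\<Sum>i | C x i \<noteq> 0. C x i) = 0"
      by (simp only: sum.empty)
    moreover have "x = (\<Sum>i | C x i \<noteq> 0. C x i)"
      using dec_C[of x] unfolding dec_def by blast
    ultimately show False
      using assms by argo
  qed
  then obtain i where i: "C x i \<noteq> 0"
    by blast
  interpret vs: vector_space_pair scale "(*) :: complex \<Rightarrow> complex \<Rightarrow> complex"
    by unfold_locales (auto simp: algebra_simps)
  have "independent {C x i}"
    using i by (simp add: dependent_single)
  from vs.linear_independent_extend[OF this, of "\<lambda>_. 1"]
  obtain \<phi> where \<phi>: "Vector_Spaces.linear scale (*) \<phi>" "\<phi> (C x i) = 1"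
    by auto
  interpret \<phi>: Vector_Spaces.linear scale "(*)" \<phi>
    by (rule \<phi>(1))
  define u where "u = (\<lambda>y. \<phi> (C y i))"
  have "Vector_Spaces.linear scale (*) u"
    unfolding Vector_Spaces.linear_iff
    using \<phi>(1)[unfolded Vector_Spaces.linear_iff]
    by (simp add: u_def C_eq[OF dec_add[OF dec_C dec_C]] C_eq[OF dec_scale[OF dec_C]] \<phi>.add \<phi>.scale)
  moreover have "finite {(h, hb). \<exists>y\<in>gr h hb. u y \<noteq> 0}"
  proof (rule finite_subset)
    show "{(h, hb). \<exists>y\<in>gr h hb. u y \<noteq> 0} \<subseteq> {i}"
    proof clarify
      fix h hb y assume y: "y \<in> gr h hb" "u y \<noteq> 0"
      have "dec y (\<lambda>j. if j = (h, hb) then y else 0)"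
      proof (cases "y = 0")
        case True
        then show ?thesis
          by (simp add: dec_def subspace_0[OF gr_subspace])
      next
        case False
        then have "{j. (if j = (h, hb) then y else 0) \<noteq> 0} = {(h, hb)}"
          by auto
        then show ?thesis
          using y(1) by (simp add: dec_def subspace_0[OF gr_subspace])
      qed
      from C_eq[OF this] show "(h, hb) = i"
        using y(2) by (auto simp: u_def \<phi>.zero split: if_splits)
    qed
  qed simp
  ultimately have "u \<in> restricted_dual scale gr"
    by (simp add: restricted_dual_def)
  moreover have "u x \<noteq> 0"
    by (simp add: u_def \<phi>(2))
  ultimately show ?thesis
    by (rule that)
qed

lemma restricted_dual_linear:
  "u \<in> restricted_dual scale gr \<Longrightarrow> Vector_Spaces.linear scale (*) u"
  by (simp add: restricted_dual_def)

lemma Y_0_left: "Y 0 r s b = 0"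
proof -
  interpret L: Vector_Spaces.linear scale scale "\<lambda>a. Y a r s b"
    by (rule Y_linear_left)
  show ?thesis
    by (rule L.zero)
qed

lemma Y_0_right: "Y a r s 0 = 0"
proof -
  interpret L: Vector_Spaces.linear scale scale "Y a r s"
    by (rule Y_linear_right)
  show ?thesis
    by (rule L.zero)
qed

text \<open>
  In the associativity axiom for \<open>a\<close> and the vacuum, the product side is constant in \<open>z2\<close>, so \<open>g\<close> is
  a constant \<open>\<kappa>\<close>, and the iterate side is the expansion of \<open>\<kappa> (z2 + z0)^A (zbar2 + zbar0)^B\<close>.
  Its coefficient of \<open>zbar0 z2^A zbar2^(B-1)\<close> is \<open>B \<kappa>\<close>, and it comes from \<open>Dbar a\<close>; this is the identity between
  \<open>Y(Dbar a, z)\<close> and the derivative of \<open>Y(a, z)\<close> by \<open>zbar\<close>.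
\<close>

lemma ker_Dbar_mode_support:
  assumes a: "a \<in> ker_Dbar Y vac" and nz: "Y a r s c \<noteq> 0"
  shows "r \<in> \<int> \<and> s = - 1"
proof -
  have rs: "r - s \<in> \<int>"
    using Y_support[of a] nz unfolding R_support_def by blast
  obtain u where u: "u \<in> restricted_dual scale gr" "u (Y a r s c) \<noteq> 0"
    using restricted_dual_separates[OF nz] .
  interpret u: Vector_Spaces.linear scale "(*)" u
    by (rule restricted_dual_linear[OF u(1)])
  define A B where "A = - r - 1" and "B = - s - 1"
  have AB: "A - B \<in> \<int>"
    using Ints_minus[OF rs] by (simp add: A_def B_def)
  define \<kappa> where "\<kappa> = u (Y a r s c)"
  obtain \<mu> where \<mu>: "GCor2 \<mu>
      (\<lambda>x y x' y'. u (Y a (- x - 1) (- y - 1) (Y vac (- x' - 1) (- y' - 1) c)))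
      (\<lambda>x y x' y'. u (Y (Y a (- x' - 1) (- y' - 1) vac) (- x - 1) (- y - 1) c))
      (\<lambda>x y x' y'. u (Y vac (- x - 1) (- y - 1) (Y a (- x' - 1) (- y' - 1) c)))"
    using FV5[OF u(1)] by blast
  obtain g where g: "complexifiable_on g (- {0, 1})"
    "expands (\<lambda>r s. u (Y a (- (A - r) - 1) (- (B - s) - 1) (Y vac (- r - 1) (- s - 1) c))) g"
    "expands (\<lambda>r s. u (Y (Y a (- r - 1) (- s - 1) vac) (- (A - r) - 1) (- (B - s) - 1) c))
      (\<lambda>w. cpow A B (1 + w) * g (1 / (1 + w)))"
    using GCor2_expansions[OF \<mu> AB] by blast
  have eq: "(\<lambda>r' s'. u (Y a (- (A - r') - 1) (- (B - s') - 1) (Y vac (- r' - 1) (- s' - 1) c))) =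
      (\<lambda>r' s'. if r' = 0 \<and> s' = 0 then \<kappa> else 0)"
    by (intro ext) (auto simp: FV4 Y_0_right u.zero A_def B_def \<kappa>_def)
  have "expands (\<lambda>r' s'. if r' = 0 \<and> s' = 0 then \<kappa> else 0) g"
    using g(2) unfolding eq .
  then obtain R where R: "R > 0" "\<And>q. 0 < cmod q \<Longrightarrow> cmod q < R \<Longrightarrow>
      ((\<lambda>(r', s'). (if r' = 0 \<and> s' = 0 then \<kappa> else 0) * cpow r' s' q) has_sum g q) UNIV"
    unfolding expands_def by blast
  have "g q = \<kappa>" if q: "0 < cmod q" "cmod q < R" for q
  proof -
    have "((\<lambda>(r', s'). (if r' = 0 \<and> s' = 0 then \<kappa> else 0) * cpow r' s' q) has_sum \<kappa>) UNIV"
      by (rule has_sum_finite_neutralI[of "{(0, 0)}"]) (use q in \<open>auto simp: cpow_0_0 split: if_splits\<close>)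
    then show ?thesis
      using has_sum_unique R(2)[OF q] by blast
  qed
  note g_const = complexifiable_on_const_germ[OF g(1) R(1) this]
  have "expands (\<lambda>r s. u (Y (Y a (- r - 1) (- s - 1) vac) (- (A - r) - 1) (- (B - s) - 1) c))
      (\<lambda>w. cpow A B (1 + w) * \<kappa>)"
  proof (rule expands_cong[OF g(3), where R = 1])
    fix q :: complex assume q: "0 < cmod q" "cmod q < 1"
    then have q1: "1 + q \<noteq> 0"
      by (metis add_eq_0_iff norm_minus_cancel norm_one less_irrefl)
    then have "g (1 / (1 + q)) = \<kappa>"
      using q by (intro g_const) (auto simp: field_simps)
    then show "cpow A B (1 + q) * g (1 / (1 + q)) = cpow A B (1 + q) * \<kappa>"
      by simp
  qed simp
  then have "u (Y (Y a (- 0 - 1) (- 1 - 1) vac) (- (A - 0) - 1) (- (B - 1) - 1) c) = B * \<kappa>"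
  proof (rule expands_cpow_coeff_0_1[OF _ AB])
    fix r' s' assume "u (Y (Y a (- r' - 1) (- s' - 1) vac) (- (A - r') - 1) (- (B - s') - 1) c) \<noteq> 0"
    then have "Y a (- r' - 1) (- s' - 1) vac \<noteq> 0"
      using Y_0_left u.zero by metis
    from FV3_support[OF this] show "r' \<in> \<nat> \<and> s' \<in> \<nat>"
      by simp
  qed
  moreover have "Y a (- 0 - 1) (- 1 - 1) vac = 0"
    using a by (simp add: ker_Dbar_def Dbar_def)
  ultimately have "B = 0"
    using u(2) by (simp add: Y_0_left u.zero \<kappa>_def)
  then show ?thesis
    using rs by (auto simp: B_def algebra_simps dest: Ints_diff[OF _ Ints_1])
qed

text \<open>
  Now \<open>c\<close> is the vacuum and the bidegree has \<open>B = 1\<close>.  Neither \<open>Y(a, z1)\<close> nor \<open>Y(b, z2)\<close> contains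
  \<open>zbar\<close>, so the product side has no component with \<open>B = 1\<close>.  Hence \<open>g\<close> vanishes, and with it the
  iterate side, which contains the coefficients of \<open>Dbar (a(n, -1) b)\<close>.
\<close>

lemma ker_Dbar_closed:
  assumes a: "a \<in> ker_Dbar Y vac" and b: "b \<in> ker_Dbar Y vac"
  shows "Y a (of_int n) (- 1) b \<in> ker_Dbar Y vac"
proof (rule ccontr)
  assume "Y a (of_int n) (- 1) b \<notin> ker_Dbar Y vac"
  then have nz: "Y (Y a (of_int n) (- 1) b) (- 1) (- 2) vac \<noteq> 0"
    by (simp add: ker_Dbar_def Dbar_def)
  obtain u where u: "u \<in> restricted_dual scale gr" "u (Y (Y a (of_int n) (- 1) b) (- 1) (- 2) vac) \<noteq> 0"
    using restricted_dual_separates[OF nz] .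
  interpret u: Vector_Spaces.linear scale "(*)" u
    by (rule restricted_dual_linear[OF u(1)])
  define A :: real where "A = of_int (- n - 1)"
  have AB: "A - 1 \<in> \<int>"
    by (simp add: A_def)
  obtain \<mu> where \<mu>: "GCor2 \<mu>
      (\<lambda>x y x' y'. u (Y a (- x - 1) (- y - 1) (Y b (- x' - 1) (- y' - 1) vac)))
      (\<lambda>x y x' y'. u (Y (Y a (- x' - 1) (- y' - 1) b) (- x - 1) (- y - 1) vac))
      (\<lambda>x y x' y'. u (Y b (- x - 1) (- y - 1) (Y a (- x' - 1) (- y' - 1) vac)))"
    using FV5[OF u(1)] by blast
  obtain g where g: "complexifiable_on g (- {0, 1})"
    "expands (\<lambda>r s. u (Y a (- (A - r) - 1) (- (1 - s) - 1) (Y b (- r - 1) (- s - 1) vac))) g"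
    "expands (\<lambda>r s. u (Y (Y a (- r - 1) (- s - 1) b) (- (A - r) - 1) (- (1 - s) - 1) vac))
      (\<lambda>w. cpow A 1 (1 + w) * g (1 / (1 + w)))"
    using GCor2_expansions[OF \<mu> AB] by blast
  have S12: "Y a (- (A - r) - 1) (- (1 - s) - 1) (Y b (- r - 1) (- s - 1) vac) = 0" for r s
  proof (rule ccontr)
    assume *: "Y a (- (A - r) - 1) (- (1 - s) - 1) (Y b (- r - 1) (- s - 1) vac) \<noteq> 0"
    then have "Y b (- r - 1) (- s - 1) vac \<noteq> 0"
      using Y_0_right by metis
    then show False
      using ker_Dbar_mode_support[OF a *] ker_Dbar_mode_support[OF b] by fastforce
  qed
  have "expands (\<lambda>r s. 0) g"
    using g(2) unfolding S12 u.zero .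
  then obtain R where R: "R > 0" "\<And>q. 0 < cmod q \<Longrightarrow> cmod q < R \<Longrightarrow>
      ((\<lambda>(r, s). 0 * cpow r s q) has_sum g q) UNIV"
    unfolding expands_def by blast
  have "g q = 0" if q: "0 < cmod q" "cmod q < R" for q
    by (rule has_sum_unique[OF R(2)[OF q] has_sum_0]) auto
  note g_zero = complexifiable_on_const_germ[OF g(1) R(1) this]
  have "expands (\<lambda>r s. u (Y (Y a (- r - 1) (- s - 1) b) (- (A - r) - 1) (- (1 - s) - 1) vac)) (\<lambda>w. 0)"
  proof (rule expands_cong[OF g(3), where R = 1])
    fix q :: complex assume q: "0 < cmod q" "cmod q < 1"
    then have q1: "1 + q \<noteq> 0"
      by (metis add_eq_0_iff norm_minus_cancel norm_one less_irrefl)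
    then have "g (1 / (1 + q)) = 0"
      using q by (intro g_zero) (auto simp: field_simps)
    then show "cpow A 1 (1 + q) * g (1 / (1 + q)) = 0"
      by simp
  qed simp
  moreover have "r \<in> \<int> \<and> s = 0"
    if "u (Y (Y a (- r - 1) (- s - 1) b) (- (A - r) - 1) (- (1 - s) - 1) vac) \<noteq> 0" for r s
  proof -
    have "Y a (- r - 1) (- s - 1) b \<noteq> 0"
      using that Y_0_left u.zero by metis
    from ker_Dbar_mode_support[OF a this] show ?thesis
      using minus_in_Ints_iff[of r] Ints_add[OF _ Ints_1, of "- r - 1"] by auto
  qed
  ultimately obtain R where R: "R > 0" "\<And>t. 0 < cmod t \<Longrightarrow> cmod t < R \<Longrightarrow>
    ((\<lambda>m :: int. u (Y (Y a (- of_int m - 1) (- 0 - 1) b) (- (A - of_int m) - 1) (- (1 - 0) - 1) vac) * t powi m) has_sum 0) UNIV"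
    using expands_on_integers by blast
  have "u (Y (Y a (- of_int (- n - 1) - 1) (- 0 - 1) b) (- (A - of_int (- n - 1)) - 1) (- (1 - 0) - 1) vac) = 0"
    using R(1) by (intro has_sum_laurent_zero[of "R / 2", where n = "- n - 1"] R(2)) auto
  then show False
    using u(2) by (simp add: A_def)
qed

lemma finite_nonzero_modes: "finite {i :: nat. Y a (real_of_int (n + int i)) (- 1) b \<noteq> 0}"
proof -
  obtain N where N: "\<And>r s. r \<ge> N \<or> s \<ge> N \<Longrightarrow> Y a r s b = 0"
    using FV1[of a b] by blast
  have "{i :: nat. Y a (real_of_int (n + int i)) (- 1) b \<noteq> 0} \<subseteq> {..nat \<lceil>N - real_of_int n\<rceil>}"
  proof
    fix i assume "i \<in> {i :: nat. Y a (real_of_int (n + int i)) (- 1) b \<noteq> 0}"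
    then have "real_of_int (n + int i) < N"
      using N[of "real_of_int (n + int i)" "- 1"] by force
    then show "i \<in> {..nat \<lceil>N - real_of_int n\<rceil>}"
      by simp linarith
  qed
  then show ?thesis
    by (rule finite_subset) simp
qed

lemma restricted_dual_has_sum:
  assumes "u \<in> restricted_dual scale gr" "finite {i. f i \<noteq> 0}"
  shows "((\<lambda>i. u (f i)) has_sum u (Sum_any f)) UNIV"
proof -
  interpret u: Vector_Spaces.linear scale "(*)" u
    by (rule restricted_dual_linear[OF assms(1)])
  show ?thesis
    by (rule has_sum_finite_neutralI[OF assms(2)]) (auto simp: Sum_any.expand_set u.sum u.zero)
qed

text \<open>
  Both sides have the same image under every \<open>u\<close> in the restricted dual.  The bidegree is chosen so
  that the modes in the identity occur; since \<open>B = 0\<close> and \<open>Y(a, z)\<close> does not contain \<open>zbar\<close>, all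
  three expansions are Laurent series in one variable, and \<open>g\<close> is holomorphic.  The vector \<open>b\<close> is
  arbitrary.
\<close>

lemma ker_Dbar_borcherds:
  assumes a: "a \<in> ker_Dbar Y vac"
  shows "Sum_any (\<lambda>i. scale (of_int p gchoose i)
      (Y (Y a (real_of_int (r + int i)) (- 1) b) (real_of_int (p + q - int i)) (- 1) c)) =
    Sum_any (\<lambda>i. scale ((- 1) ^ i * (of_int r gchoose i))
      (Y a (real_of_int (p + r - int i)) (- 1) (Y b (real_of_int (q + int i)) (- 1) c)
        - scale ((- 1) powi r) (Y b (real_of_int (q + r - int i)) (- 1) (Y a (real_of_int (p + int i)) (- 1) c))))"
    (is "Sum_any ?L = Sum_any ?R")
proof (rule ccontr)
  assume "Sum_any ?L \<noteq> Sum_any ?R"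
  then have "Sum_any ?L - Sum_any ?R \<noteq> 0"
    by simp
  then obtain u where u: "u \<in> restricted_dual scale gr" "u (Sum_any ?L - Sum_any ?R) \<noteq> 0"
    by (rule restricted_dual_separates)
  interpret u: Vector_Spaces.linear scale "(*)" u
    by (rule restricted_dual_linear[OF u(1)])
  define A where "A = - (p + q + r) - 2"
  have AB: "of_int A - 0 \<in> \<int>"
    by simp
  obtain \<mu> where \<mu>: "GCor2 \<mu>
      (\<lambda>x y x' y'. u (Y a (- x - 1) (- y - 1) (Y b (- x' - 1) (- y' - 1) c)))
      (\<lambda>x y x' y'. u (Y (Y a (- x' - 1) (- y' - 1) b) (- x - 1) (- y - 1) c))
      (\<lambda>x y x' y'. u (Y b (- x - 1) (- y - 1) (Y a (- x' - 1) (- y' - 1) c)))"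
    using FV5[OF u(1)] by blast
  let ?S12 = "\<lambda>r s. u (Y a (- (of_int A - r) - 1) (- (0 - s) - 1) (Y b (- r - 1) (- s - 1) c))"
  let ?S20 = "\<lambda>r s. u (Y (Y a (- r - 1) (- s - 1) b) (- (of_int A - r) - 1) (- (0 - s) - 1) c)"
  let ?S21 = "\<lambda>r s. u (Y b (- (of_int A - r) - 1) (- (0 - s) - 1) (Y a (- r - 1) (- s - 1) c))"
  obtain g where g: "complexifiable_on g (- {0, 1})" "expands ?S12 g"
    "expands ?S20 (\<lambda>w. cpow (of_int A) 0 (1 + w) * g (1 / (1 + w)))"
    "expands ?S21 (\<lambda>t. cpow (of_int A) 0 t * g (1 / t))"
    using GCor2_expansions[OF \<mu> AB] by blast
  have int_shift: "x \<in> \<int> \<and> y = 0" if "- x - 1 \<in> \<int> \<and> - y - 1 = - 1" for x y :: real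
    using that minus_in_Ints_iff[of x] Ints_add[OF _ Ints_1, of "- x - 1"] by auto
  have supp12: "x \<in> \<int> \<and> y = 0" if "?S12 x y \<noteq> 0" for x y
  proof -
    have "Y a (- (of_int A - x) - 1) (- (0 - y) - 1) (Y b (- x - 1) (- y - 1) c) \<noteq> 0"
      using that u.zero by metis
    from ker_Dbar_mode_support[OF a this] have "x - of_int (A + 1) \<in> \<int>" "y = 0"
      by (auto simp: algebra_simps)
    then show ?thesis
      using Ints_add[OF _ Ints_of_int, of "x - of_int (A + 1)" "A + 1"] by simp
  qed
  have supp20: "x \<in> \<int> \<and> y = 0" if "?S20 x y \<noteq> 0" for x y
  proof (rule int_shift, rule ker_Dbar_mode_support[OF a])
    show "Y a (- x - 1) (- y - 1) b \<noteq> 0"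
      using that Y_0_left u.zero by metis
  qed
  have supp21: "x \<in> \<int> \<and> y = 0" if "?S21 x y \<noteq> 0" for x y
  proof (rule int_shift, rule ker_Dbar_mode_support[OF a])
    show "Y a (- x - 1) (- y - 1) c \<noteq> 0"
      using that Y_0_right u.zero by metis
  qed
  obtain R12 where R12: "R12 > 0" "\<And>t. 0 < cmod t \<Longrightarrow> cmod t < R12 \<Longrightarrow>
      ((\<lambda>m :: int. ?S12 (of_int m) 0 * t powi m) has_sum g t) UNIV"
    using expands_on_integers[OF g(2) supp12] by blast
  obtain R20 where R20: "R20 > 0" "\<And>t. 0 < cmod t \<Longrightarrow> cmod t < R20 \<Longrightarrow>
      ((\<lambda>m :: int. ?S20 (of_int m) 0 * t powi m) has_sum (cpow (of_int A) 0 (1 + t) * g (1 / (1 + t)))) UNIV"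
    using expands_on_integers[OF g(3) supp20] by blast
  obtain R21 where R21: "R21 > 0" "\<And>t. 0 < cmod t \<Longrightarrow> cmod t < R21 \<Longrightarrow>
      ((\<lambda>m :: int. ?S21 (of_int m) 0 * t powi m) has_sum (cpow (of_int A) 0 t * g (1 / t))) UNIV"
    using expands_on_integers[OF g(4) supp21] by blast
  define R where "R = min (min R12 1) (min R20 R21)"
  have R: "R > 0" "R \<le> R12" "R \<le> R20" "R \<le> R21" "R \<le> 1"
    using R12(1) R20(1) R21(1) by (auto simp: R_def)
  have hol: "g holomorphic_on - {0, 1}"
  proof -
    have "g holomorphic_on ball 0 R - {0}"
      by (rule laurent_has_sum_holomorphic, rule R12(2)) (use R in auto)
    moreover have "of_real (R / 2) \<in> ball 0 R - {0 :: complex}"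
      using R(1) by auto
    then have "ball 0 R - {0 :: complex} \<noteq> {}"
      by blast
    moreover have "open (ball 0 R - {0 :: complex})" "open (- {0, 1 :: complex})"
      by auto
    moreover have "ball 0 R - {0} \<subseteq> - {0, 1 :: complex}"
      using R(5) by auto
    ultimately show ?thesis
      using complexifiable_on_holomorphic[OF g(1) _ connected_minus_0_1] by blast
  qed
  obtain x12 x20 x21 where x:
    "((\<lambda>i. (- 1) ^ i * (of_int r gchoose i) * ?S12 (of_int (A + 1 + p + r - int i)) 0) has_sum x12) UNIV"
    "((\<lambda>i. (of_int p gchoose i) * ?S20 (of_int (- 1 - (r + int i))) 0) has_sum x20) UNIV"
    "((\<lambda>i. (- 1) ^ i * (of_int r gchoose i) * ((- 1) powi r * ?S21 (of_int (- 1 - (p + int i))) 0)) has_sum x21) UNIV"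
    "x20 = x12 - x21"
  proof (rule residue_identity[OF hol R(1), of "\<lambda>m. ?S12 (of_int m) 0" "\<lambda>m. ?S20 (of_int m) 0" A "\<lambda>m. ?S21 (of_int m) 0" r p])
    fix t :: complex assume t: "0 < cmod t" "cmod t < R"
    then have t0: "t \<noteq> 0" "1 + t \<noteq> 0"
      using R(5) by (auto simp: add_eq_0_iff)
    show "((\<lambda>m :: int. ?S12 (of_int m) 0 * t powi m) has_sum g t) UNIV"
      using t R by (intro R12(2)) auto
    show "((\<lambda>m :: int. ?S20 (of_int m) 0 * t powi m) has_sum (1 + t) powi A * g (1 / (1 + t))) UNIV"
      unfolding cpow_of_int[OF t0(2), symmetric] using t R by (intro R20(2)) auto
    show "((\<lambda>m :: int. ?S21 (of_int m) 0 * t powi m) has_sum t powi A * g (1 / t)) UNIV"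
      using R21(2)[OF t(1)] t(2) R(4) cpow_of_int[OF t0(1), of A] by simp
  qed
  have "((\<lambda>i. u (?L i)) has_sum u (Sum_any ?L)) UNIV"
    by (rule restricted_dual_has_sum[OF u(1)], rule finite_subset[OF _ finite_nonzero_modes[of a r b]])
       (auto simp: Y_0_left)
  moreover have "((\<lambda>i. u (?L i)) has_sum x20) UNIV"
    using x(2) by (simp add: u.scale A_def algebra_simps)
  ultimately have L: "u (Sum_any ?L) = x20"
    using has_sum_unique by blast
  have "((\<lambda>i. u (?R i)) has_sum u (Sum_any ?R)) UNIV"
  proof (rule restricted_dual_has_sum[OF u(1)], rule finite_subset)
    show "finite ({i :: nat. Y b (real_of_int (q + int i)) (- 1) c \<noteq> 0} \<union> {i :: nat. Y a (real_of_int (p + int i)) (- 1) c \<noteq> 0})"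
      using finite_nonzero_modes by blast
  qed (auto simp: Y_0_right)
  moreover have "((\<lambda>i. u (?R i)) has_sum (x12 + - 1 * x21)) UNIV"
    using has_sum_add[OF x(1) has_sum_cmult_right[OF x(3), of "- 1"]]
    by (simp add: u.scale u.diff A_def algebra_simps)
  ultimately have "u (Sum_any ?R) = x12 + - 1 * x21"
    using has_sum_unique by blast
  with L x(4) u(2) show False
    by (simp add: u.diff)
qed

lemma subspace_ker_Dbar: "subspace (ker_Dbar Y vac)"
proof -
  interpret D: Vector_Spaces.linear scale scale "\<lambda>a. Y a (- 1) (- 2) vac"
    by (rule Y_linear_left)
  show ?thesis
    by (auto simp: subspace_def ker_Dbar_def Dbar_def D.zero D.add D.scale)
qed

end

theorem proposition2p4:
  fixes scale :: "complex \<Rightarrow> 'a :: ab_group_add \<Rightarrow> 'a"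
    and gr :: "real \<Rightarrow> real \<Rightarrow> 'a set"
    and vac :: 'a
    and Y :: "'a \<Rightarrow> real \<Rightarrow> real \<Rightarrow> 'a \<Rightarrow> 'a"
  assumes "full_vertex_algebra scale gr vac Y"
  shows "vertex_algebra scale (ker_Dbar Y vac) vac (\<lambda>a n. Y a (real_of_int n) (- 1))
    \<and> vertex_algebra_module scale (ker_Dbar Y vac) vac (\<lambda>a n. Y a (real_of_int n) (- 1))
        scale UNIV (\<lambda>a n. Y a (real_of_int n) (- 1))
    \<and> (\<forall>a\<in>ker_Dbar Y vac. \<forall>r s b. Y a r s b \<noteq> 0 \<longrightarrow> r \<in> \<int> \<and> s = - 1)"
proof -
  interpret full_vertex_algebra scale gr vac Y
    by (rule assms)
  let ?V = "ker_Dbar Y vac" and ?Y = "\<lambda>a n. Y a (real_of_int n) (- 1)"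
  have lin_left: "lin_on scale W scale W' (\<lambda>a. Y a r s b)" if "\<And>a. a \<in> W \<Longrightarrow> Y a r s b \<in> W'" for W W' r s b
  proof -
    interpret L: Vector_Spaces.linear scale scale "\<lambda>a. Y a r s b"
      by (rule Y_linear_left)
    show ?thesis
      using that by (auto simp: lin_on_def L.add L.scale)
  qed
  have lin_right: "lin_on scale W scale W' (Y a r s)" if "\<And>b. b \<in> W \<Longrightarrow> Y a r s b \<in> W'" for W W' r s a
  proof -
    interpret L: Vector_Spaces.linear scale scale "Y a r s"
      by (rule Y_linear_right)
    show ?thesis
      using that by (auto simp: lin_on_def L.add L.scale)
  qed
  have trunc: "\<exists>N. \<forall>n\<ge>N. Y a (real_of_int n) (- 1) b = 0" for a b
  proof -
    obtain N where N: "\<And>r s. r \<ge> N \<or> s \<ge> N \<Longrightarrow> Y a r s b = 0"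
      using FV1[of a b] by blast
    show ?thesis
      using N by (intro exI[of _ "\<lceil>N\<rceil>"]) (auto simp: ceiling_le_iff)
  qed
  have borch: "borcherds_identity ?V ?Y scale M ?Y" for M
    unfolding borcherds_identity_def using ker_Dbar_borcherds by blast
  have va: "vertex_algebra scale ?V vac ?Y"
  proof unfold_locales
    show "subspace ?V"
      by (rule subspace_ker_Dbar)
    show "vac \<in> ?V"
      by (simp add: ker_Dbar_def Dbar_def FV4)
    show "lin_on scale ?V scale ?V (\<lambda>a. ?Y a n b)" if "b \<in> ?V" for n b
      using ker_Dbar_closed that by (intro lin_left) auto
    show "lin_on scale ?V scale ?V (?Y a n)" if "a \<in> ?V" for n a
      using ker_Dbar_closed that by (intro lin_right) auto
    show "?Y a n vac = 0" if "n \<ge> 0" for a n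
    proof (rule ccontr)
      assume "?Y a n vac \<noteq> 0"
      then have "- real_of_int n - 1 \<in> \<nat>"
        using FV3_support by blast
      then show False
        using that by (auto elim!: Nats_cases)
    qed
  qed (use trunc borch in \<open>auto simp: FV4 FV3_const\<close>)
  interpret va: vertex_algebra scale ?V vac ?Y
    by (rule va)
  have "vertex_algebra_module scale ?V vac ?Y scale UNIV ?Y"
  proof unfold_locales
    show "lin_on scale ?V scale UNIV (\<lambda>a. ?Y a n b)" for n b
      by (intro lin_left) auto
    show "lin_on scale UNIV scale UNIV (?Y a n)" for n a
      by (intro lin_right) auto
  qed (use trunc borch in \<open>auto simp: FV4\<close>)
  with va ker_Dbar_mode_support show ?thesis
    by blast
qed

end
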